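(* Let $g\ge2$ and $G=\pi_1(\Sigma_g)=\langle c_1,\dots,c_{2g}\mid c_1\cdots c_{2g}c_1^{-1}\cdots c_{2g}^{-1}\rangle$. Let $E(n)$ be the number of elements of $G$ of word length at most $n$ with respect to $\{c_1,\dots,c_{2g}\}$. Then $$4g-1-\frac{8g-1}{(4g-2)^{2g-1}}\le\limsup_{n\to\infty}\sqrt[n]{E(n)}\le 4g-1-\frac{2}{(4g-1)^{2g}}.$$
   Context: The word length of $x\in G$ is the minimal $n$ such that $x$ is a product of $n$ elements of $\{c_1^{\pm1},\dots,c_{2g}^{\pm1}\}$. *)

theory Defs
  imports "HOL-Library.Extended_Real" "HOL-Algebra.Group"
begin

section \<open>Groups given by generators and relators\<close>

text \<open>The letter \<open>(x, True)\<close> stands for the generator \<open>x\<close> and \<open>(x, False)\<close> for its formal inverse.\<close>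

type_synonym 'a word = "('a \<times> bool) list"

definition words :: "'a set \<Rightarrow> 'a word set" where
  "words X = lists (X \<times> UNIV)"

text \<open>
  Two words represent the same element of \<open>\<langle>X | R\<rangle>\<close> iff they are related by the smallest
  congruence on the monoid of words that identifies \<open>x x\<^sup>-\<^sup>1\<close>, \<open>x\<^sup>-\<^sup>1 x\<close> and all relators
  with the empty word.
\<close>

inductive word_eq :: "'a set \<Rightarrow> 'a word set \<Rightarrow> 'a word \<Rightarrow> 'a word \<Rightarrow> bool"
  for X :: "'a set" and R :: "'a word set" where
  refl: "w \<in> words X \<Longrightarrow> word_eq X R w w"
| sym: "word_eq X R u v \<Longrightarrow> word_eq X R v u"
| trans: "word_eq X R u v \<Longrightarrow> word_eq X R v w \<Longrightarrow> word_eq X R u w"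
| cancel: "u \<in> words X \<Longrightarrow> v \<in> words X \<Longrightarrow> x \<in> X \<Longrightarrow>
    word_eq X R (u @ [(x, b), (x, \<not> b)] @ v) (u @ v)"
| relator: "u \<in> words X \<Longrightarrow> v \<in> words X \<Longrightarrow> r \<in> R \<Longrightarrow> r \<in> words X \<Longrightarrow>
    word_eq X R (u @ r @ v) (u @ v)"

definition word_rel :: "'a set \<Rightarrow> 'a word set \<Rightarrow> ('a word \<times> 'a word) set" where
  "word_rel X R = {(u, v). word_eq X R u v}"

definition presented_group :: "'a set \<Rightarrow> 'a word set \<Rightarrow> 'a word set monoid" where
  "presented_group X R =
    \<lparr>carrier = words X // word_rel X R,
     mult = (\<lambda>A B. \<Union>u\<in>A. \<Union>v\<in>B. word_rel X R `` {u @ v}),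
     one = word_rel X R `` {[]}\<rparr>"

definition gen_class :: "'a set \<Rightarrow> 'a word set \<Rightarrow> 'a \<Rightarrow> 'a word set" where
  "gen_class X R x = word_rel X R `` {[(x, True)]}"


section \<open>Word length and growth\<close>

definition word_length :: "('a, 'b) monoid_scheme \<Rightarrow> 'a set \<Rightarrow> 'a \<Rightarrow> nat" where
  "word_length G S x =
    (LEAST n. \<exists>ys. length ys = n \<and> set ys \<subseteq> S \<union> m_inv G ` S \<and>
       foldr (mult G) ys (one G) = x)"

definition ball_size :: "('a, 'b) monoid_scheme \<Rightarrow> 'a set \<Rightarrow> nat \<Rightarrow> nat" where
  "ball_size G S n = card {x \<in> carrier G. word_length G S x \<le> n}"


section \<open>Surface groups\<close>

definition surface_relator :: "nat \<Rightarrow> nat word" where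
  "surface_relator g =
    map (\<lambda>i. (i, True)) [1..<2 * g + 1] @ map (\<lambda>i. (i, False)) [1..<2 * g + 1]"

definition surface_group :: "nat \<Rightarrow> nat word set monoid" where
  "surface_group g = presented_group {1..2 * g} {surface_relator g}"

definition surface_gens :: "nat \<Rightarrow> nat word set set" where
  "surface_gens g = gen_class {1..2 * g} {surface_relator g} ` {1..2 * g}"


section \<open>Basic properties\<close>

lemma words_simps [simp]:
  "[] \<in> words X"
  "a # u \<in> words X \<longleftrightarrow> fst a \<in> X \<and> u \<in> words X"
  "u @ v \<in> words X \<longleftrightarrow> u \<in> words X \<and> v \<in> words X"
  by (cases a; auto simp: words_def)+

lemma word_eq_words: "word_eq X R u v \<Longrightarrow> u \<in> words X \<and> v \<in> words X"
  by (induction rule: word_eq.induct) auto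

lemma word_eq_context:
  assumes "word_eq X R u v" "p \<in> words X" "q \<in> words X"
  shows "word_eq X R (p @ u @ q) (p @ v @ q)"
  using assms
proof (induction rule: word_eq.induct)
  case (refl w)
  then show ?case by (simp add: word_eq.refl)
next
  case (sym u v)
  then show ?case by (blast intro: word_eq.sym)
next
  case (trans u v w)
  then show ?case by (blast intro: word_eq.trans)
next
  case (cancel u v x b)
  then show ?case using word_eq.cancel[of "p @ u" X "v @ q" x R b] by simp
next
  case (relator u v r)
  then show ?case using word_eq.relator[of "p @ u" X "v @ q" r R] by simp
qed

lemma word_eq_append:
  assumes "word_eq X R u u'" "word_eq X R v v'"
  shows "word_eq X R (u @ v) (u' @ v')"
proof (rule word_eq.trans)
  show "word_eq X R (u @ v) (u' @ v)"
    using word_eq_context[OF assms(1), of "[]" v] word_eq_words[OF assms(2)] by simp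
  show "word_eq X R (u' @ v) (u' @ v')"
    using word_eq_context[OF assms(2), of u' "[]"] word_eq_words[OF assms(1)] by simp
qed

lemma equiv_word_rel: "equiv (words X) (word_rel X R)"
proof (rule equivI)
  show "word_rel X R \<subseteq> words X \<times> words X"
    by (auto simp: word_rel_def dest: word_eq_words)
  show "refl_on (words X) (word_rel X R)"
    by (simp add: refl_on_def word_rel_def word_eq.refl)
  show "sym (word_rel X R)"
    by (auto simp: word_rel_def intro: symI word_eq.sym)
  show "trans (word_rel X R)"
    unfolding word_rel_def by (rule transI) (simp, erule (1) word_eq.trans)
qed

lemma word_class_mult:
  assumes "u \<in> words X" "v \<in> words X"
  shows "mult (presented_group X R) (word_rel X R `` {u}) (word_rel X R `` {v}) =
    word_rel X R `` {u @ v}"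
proof -
  have "congruent2 (word_rel X R) (word_rel X R) (\<lambda>u v. word_rel X R `` {u @ v})"
    by (intro congruent2I'  equiv_class_eq[OF equiv_word_rel])
      (auto simp: word_rel_def intro: word_eq_append)
  from UN_equiv_class2[OF equiv_word_rel equiv_word_rel this assms]
  show ?thesis by (simp add: presented_group_def)
qed

lemma word_class_carrier:
  "u \<in> words X \<Longrightarrow> word_rel X R `` {u} \<in> carrier (presented_group X R)"
  by (simp add: presented_group_def quotientI)

lemma carrierE_word_class:
  assumes "A \<in> carrier (presented_group X R)"
  obtains u where "u \<in> words X" "A = word_rel X R `` {u}"
  using assms by (auto simp: presented_group_def elim: quotientE)

lemma word_class_eq_iff:
  "u \<in> words X \<Longrightarrow> v \<in> words X \<Longrightarrow>
    word_rel X R `` {u} = word_rel X R `` {v} \<longleftrightarrow> word_eq X R u v"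
  using eq_equiv_class_iff[OF equiv_word_rel[of X R], of u v] by (simp add: word_rel_def)

lemma one_presented_group: "one (presented_group X R) = word_rel X R `` {[]}"
  by (simp add: presented_group_def)

definition inv_word :: "'a word \<Rightarrow> 'a word" where
  "inv_word w = rev (map (\<lambda>(x, b). (x, \<not> b)) w)"

lemma inv_word_words [simp]: "inv_word w \<in> words X \<longleftrightarrow> w \<in> words X"
  by (induction w) (auto simp: inv_word_def split_beta)

lemma inv_word_left: "w \<in> words X \<Longrightarrow> word_eq X R (inv_word w @ w) []"
proof (induction w)
  case Nil
  then show ?case by (simp add: inv_word_def word_eq.refl)
next
  case (Cons a w)
  obtain x b where a: "a = (x, b)" by (cases a)
  have "word_eq X R (inv_word w @ [(x, \<not> b), (x, \<not> \<not> b)] @ w) (inv_word w @ w)"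
    using Cons.prems a by (intro word_eq.cancel) auto
  moreover have "word_eq X R (inv_word w @ w) []"
    using Cons by simp
  ultimately have "word_eq X R (inv_word w @ [(x, \<not> b), (x, \<not> \<not> b)] @ w) []"
    by (rule word_eq.trans)
  then show ?case by (simp add: inv_word_def a)
qed

lemma group_presented_group: "group (presented_group X R)"
proof (rule groupI)
  fix A assume "A \<in> carrier (presented_group X R)"
  then obtain u where u: "u \<in> words X" "A = word_rel X R `` {u}" by (rule carrierE_word_class)
  show "\<exists>B\<in>carrier (presented_group X R).
      mult (presented_group X R) B A = one (presented_group X R)"
    using u by (intro bexI[of _ "word_rel X R `` {inv_word u}"])
      (simp_all add: word_class_mult word_class_carrier one_presented_group
        word_class_eq_iff inv_word_left)
qed (auto elim!: carrierE_word_class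
      simp: word_class_mult one_presented_group intro!: word_class_carrier)

lemma inv_gen_class:
  assumes "x \<in> X"
  shows "m_inv (presented_group X R) (gen_class X R x) = word_rel X R `` {[(x, False)]}"
proof -
  have "word_eq X R ([(x, False)] @ [(x, True)]) []"
    using word_eq.cancel[of "[]" X "[]" x R False] assms by simp
  then show ?thesis
    using assms unfolding gen_class_def
    by (intro group.inv_equality[OF group_presented_group])
      (simp_all add: word_class_mult word_class_carrier one_presented_group word_class_eq_iff)
qed

text \<open>Every element is a product of letters, so the minimum in \<^const>\<open>word_length\<close> is attained.\<close>

lemma presented_group_generated:
  assumes "A \<in> carrier (presented_group X R)"
  shows "\<exists>ys. set ys \<subseteq> gen_class X R ` X \<union> m_inv (presented_group X R) ` (gen_class X R ` X) \<and>
    foldr (mult (presented_group X R)) ys (one (presented_group X R)) = A"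
proof -
  let ?L = "gen_class X R ` X \<union> m_inv (presented_group X R) ` (gen_class X R ` X)"
  have letter: "word_rel X R `` {[(x, b)]} \<in> ?L" if "x \<in> X" for x b
    using that inv_gen_class[OF that, of R] by (cases b) (force simp: gen_class_def)+
  have "\<exists>ys. set ys \<subseteq> ?L \<and> foldr (mult (presented_group X R)) ys
      (one (presented_group X R)) = word_rel X R `` {w}" if "w \<in> words X" for w
    using that
  proof (induction w)
    case Nil
    then show ?case by (intro exI[of _ "[]"]) (simp add: one_presented_group)
  next
    case (Cons a w)
    obtain x b where a: "a = (x, b)" by (cases a)
    from Cons obtain ys where "set ys \<subseteq> ?L" "foldr (mult (presented_group X R)) ys
      (one (presented_group X R)) = word_rel X R `` {w}" by auto
    with Cons.prems a letter[of x b] show ?case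
      by (intro exI[of _ "word_rel X R `` {[a]} # ys"]) (auto simp: word_class_mult)
  qed
  with assms show ?thesis by (auto elim!: carrierE_word_class)
qed

text \<open>Since the generating set is finite, the cardinality in \<^const>\<open>ball_size\<close> is that of a
  finite set.\<close>

lemma finite_surface_ball:
  "finite {x \<in> carrier (surface_group g). word_length (surface_group g) (surface_gens g) x \<le> n}"
proof -
  let ?G = "surface_group g" and ?S = "surface_gens g"
  let ?L = "?S \<union> m_inv ?G ` ?S"
  let ?f = "\<lambda>ys. foldr (mult ?G) ys (one ?G)"
  have "x \<in> ?f ` {ys. set ys \<subseteq> ?L \<and> length ys \<le> n}"
    if x: "x \<in> carrier ?G" "word_length ?G ?S x \<le> n" for x
  proof -
    let ?P = "\<lambda>n. \<exists>ys. length ys = n \<and> set ys \<subseteq> ?L \<and> ?f ys = x"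
    obtain ys where ys: "set ys \<subseteq> ?L" "?f ys = x"
      using presented_group_generated[OF x(1)[unfolded surface_group_def]]
      unfolding surface_group_def surface_gens_def by (elim exE conjE)
    have "?P (length ys)"
      using ys by (intro exI[of _ ys] conjI HOL.refl)
    then have "?P (word_length ?G ?S x)"
      unfolding word_length_def by (rule LeastI[of ?P])
    then obtain zs where zs: "length zs = word_length ?G ?S x" "set zs \<subseteq> ?L" "?f zs = x"
      by (elim exE conjE)
    have "zs \<in> {ys. set ys \<subseteq> ?L \<and> length ys \<le> n}"
      unfolding mem_Collect_eq zs(1) using zs(2) x(2) by (rule conjI)
    with zs(3) show ?thesis
      by (rule image_eqI[OF HOL.sym])
  qed
  then have "{x \<in> carrier ?G. word_length ?G ?S x \<le> n} \<subseteq>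
      ?f ` {ys. set ys \<subseteq> ?L \<and> length ys \<le> n}"
    by (intro subsetI) (elim CollectE conjE)
  moreover have "finite ?S"
    unfolding surface_gens_def by (intro finite_imageI finite_atLeastAtMost)
  then have "finite (?f ` {ys. set ys \<subseteq> ?L \<and> length ys \<le> n})"
    by (intro finite_imageI finite_lists_length_le finite_UnI)
  ultimately show ?thesis
    by (rule finite_subset)
qed

end

theory Submission
  imports Defs "HOL-Library.Sublist"
begin

text \<open>
  Label the letters by \<open>\<int>/4g\<close> in the cyclic order in which the edges leave a vertex of the Cayley
  complex, so that \<open>j + 2g\<close> is the inverse of \<open>j\<close>; the factors of relators are then the progressions
  with step \<open>2g \<plusminus> 1\<close>. A shortest word is reduced and has no such factor of length \<open>2g + 1\<close>, and
  counting these words gives the upper bound.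

  For the lower bound, reduced words without relator factors of length \<open>2g\<close> represent
  pairwise different elements. The Cayley complex is the tiling by regular \<open>4g\<close>-gons with \<open>4g\<close> at
  each vertex; its dual tile has angles \<open>\<pi>/(2g)\<close>, so the reflections in the sides of that tile
  generate a Coxeter group. Hence \<open>G\<close> acts on the functionals on the root space of this group, the
  letter \<open>j\<close> being the reflection in side \<open>j\<close> followed by the symmetry of the tile that carries
  \<open>j\<close> to \<open>j + 2g\<close> and reverses the orientation. As in Tits' argument, such a word makes the constant functional \<open>1\<close> negative at exactly
  one simple root, which is determined by its last letter.
\<close>

section \<open>Word length in a presented group\<close>

text \<open>Generators and their inverses are the classes of one-letter words, so lists of them lift
  to words. The minimum over factorisations becomes a minimum over words, where subword arguments
  apply.\<close>

lemma word_length_word_class: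
  fixes X :: "'a set" and R :: "'a word set"
  defines "cls \<equiv> \<lambda>u. word_rel X R `` {u}"
  assumes w: "w \<in> words X"
  shows "word_length (presented_group X R) (gen_class X R ` X) (cls w) =
    (LEAST n. \<exists>u\<in>words X. length u = n \<and> word_eq X R u w)"
proof -
  let ?G = "presented_group X R"
  let ?L = "gen_class X R ` X \<union> m_inv ?G ` (gen_class X R ` X)"
  have "X \<times> UNIV = (\<lambda>x. (x, True)) ` X \<union> (\<lambda>x. (x, False)) ` X"
    by (auto simp: image_iff)
  moreover have "m_inv ?G ` (gen_class X R ` X) = (\<lambda>x. cls [(x, False)]) ` X"
    unfolding image_image cls_def by (intro image_cong HOL.refl inv_gen_class)
  moreover have "gen_class X R ` X = (\<lambda>x. cls [(x, True)]) ` X"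
    by (simp add: gen_class_def cls_def)
  ultimately have L: "?L = (\<lambda>l. cls [l]) ` (X \<times> UNIV)"
    by (simp add: image_Un image_image)
  have fold: "foldr (mult ?G) (map (\<lambda>l. cls [l]) u) (one ?G) = cls u" if "u \<in> words X" for u
    using that by (induction u) (auto simp: one_presented_group word_class_mult cls_def)
  have "(\<exists>ys. length ys = n \<and> set ys \<subseteq> ?L \<and> foldr (mult ?G) ys (one ?G) = cls w) \<longleftrightarrow>
      (\<exists>u\<in>words X. length u = n \<and> word_eq X R u w)" for n
  proof
    assume "\<exists>ys. length ys = n \<and> set ys \<subseteq> ?L \<and> foldr (mult ?G) ys (one ?G) = cls w"
    then obtain ys where ys: "length ys = n" "ys \<in> lists ((\<lambda>l. cls [l]) ` (X \<times> UNIV))"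
      "foldr (mult ?G) ys (one ?G) = cls w"
      unfolding L by auto
    then obtain u where "u \<in> words X" "ys = map (\<lambda>l. cls [l]) u"
      unfolding lists_image words_def by auto
    with ys fold w show "\<exists>u\<in>words X. length u = n \<and> word_eq X R u w"
      by (intro bexI[of _ u]) (auto simp: cls_def word_class_eq_iff)
  next
    assume "\<exists>u\<in>words X. length u = n \<and> word_eq X R u w"
    then obtain u where u: "u \<in> words X" "length u = n" "word_eq X R u w" by blast
    have "set (map (\<lambda>l. cls [l]) u) \<subseteq> ?L" unfolding L using u(1) by (auto simp: words_def)
    with u fold[OF u(1)] w show "\<exists>ys. length ys = n \<and> set ys \<subseteq> ?L \<and> foldr (mult ?G) ys (one ?G) = cls w"
      by (intro exI[of _ "map (\<lambda>l. cls [l]) u"]) (auto simp: cls_def word_class_eq_iff)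
  qed
  then show ?thesis by (simp add: word_length_def)
qed

lemma not_successivelyE:
  assumes "\<not> successively P w"
  obtains p a b q where "w = p @ [a, b] @ q" "\<not> P a b"
proof -
  have "\<exists>p a b q. w = p @ [a, b] @ q \<and> \<not> P a b"
    using assms
  proof (induction w rule: induct_list012)
    case (3 x y zs)
    show ?case
    proof (cases "P x y")
      case True
      then obtain p a b q where "y # zs = p @ [a, b] @ q" "\<not> P a b" using 3 by auto
      then show ?thesis by (intro exI[of _ "x # p"]) auto
    next
      case False
      then show ?thesis by (intro exI[of _ "[]"]) auto
    qed
  qed simp_all
  then show thesis using that by blast
qed

section \<open>The action on height functions\<close>

locale surface =
  fixes g :: nat
  assumes g2: "g \<ge> 2"
begin

abbreviation N :: int where "N \<equiv> 4 * int g"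

abbreviation opp :: "int \<Rightarrow> int" where "opp j \<equiv> j + 2 * int g"

definition \<theta> :: real where "\<theta> = pi / (2 * real g)"

text \<open>
  \<open>f k\<close> is the value of a functional at the simple root of side \<open>k\<close>, and the inner product of the
  roots of two sides at distance \<open>t\<close> is \<open>- coef t / 2\<close>. \<open>act j\<close> reflects in side \<open>j\<close> and
  then relabels the sides by \<open>k \<mapsto> 2j + 2g - k\<close>.
\<close>

definition coef :: "int \<Rightarrow> real" where
  "coef t = (if N dvd t - 1 \<or> N dvd t + 1 then 2 * cos \<theta> else 2)"

text \<open>Functions on the residues modulo \<open>N\<close> are encoded as periodic functions on
  the integers, so side labels can be added without reduction.\<close>

definition periodic :: "(int \<Rightarrow> real) \<Rightarrow> bool" where
  "periodic f \<longleftrightarrow> (\<forall>k l. N dvd k - l \<longrightarrow> f k = f l)"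

definition act :: "int \<Rightarrow> (int \<Rightarrow> real) \<Rightarrow> int \<Rightarrow> real" where
  "act j f k = (if N dvd k - opp j then - f j
     else f (j - (k - opp j)) + coef (k - opp j) * f j)"

lemma dvd_cong: "N dvd a - b \<Longrightarrow> N dvd a \<longleftrightarrow> N dvd b"
  by (metis dvd_diff_commute dvd_diffD dvd_diffD1 diff_add_cancel dvd_add_right_iff)

lemma coef_cong:
  assumes "N dvd a - b" shows "coef a = coef b"
proof -
  have "N dvd (a - 1) - (b - 1)" "N dvd (a + 1) - (b + 1)" using assms by simp_all
  then show ?thesis unfolding coef_def using dvd_cong by metis
qed

lemma coef_minus: "coef (- t) = coef t"
proof -
  have "N dvd - t - 1 \<longleftrightarrow> N dvd t + 1" "N dvd - t + 1 \<longleftrightarrow> N dvd t - 1"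
  proof -
    have "- t - 1 = - (t + 1)" "- t + 1 = - (t - 1)" by simp_all
    then show "N dvd - t - 1 \<longleftrightarrow> N dvd t + 1" "N dvd - t + 1 \<longleftrightarrow> N dvd t - 1"
      by (simp_all only: dvd_minus_iff)
  qed
  then show ?thesis by (auto simp: coef_def)
qed

lemma periodicD: "periodic f \<Longrightarrow> N dvd k - l \<Longrightarrow> f k = f l"
  by (auto simp: periodic_def)

lemma act_add: "act j f (opp j + t) = (if N dvd t then - f j else f (j - t) + coef t * f j)"
  by (simp add: act_def)

lemma periodic_act:
  assumes "periodic f" shows "periodic (act j f)"
  unfolding periodic_def
proof (intro allI impI)
  fix k l assume kl: "N dvd k - l"
  then have d: "N dvd (k - opp j) - (l - opp j)" "N dvd (j - (k - opp j)) - (j - (l - opp j))"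
    using dvd_minus_iff[of N "k - l"] by (simp_all add: algebra_simps)
  show "act j f k = act j f l"
    unfolding act_def using dvd_cong[OF d(1)] coef_cong[OF d(1)] periodicD[OF assms d(2)] by simp
qed

lemma act_cong:
  assumes "periodic f" "N dvd i - j" shows "act i f = act j f"
proof
  fix k
  have d: "N dvd (k - opp i) - (k - opp j)"
    using dvd_minus_iff[of N "i - j"] assms(2) by (simp add: algebra_simps)
  have e: "N dvd (i - (k - opp i)) - (j - (k - opp j))"
    using dvd_mult[OF assms(2), of 2] by (simp add: algebra_simps)
  show "act i f k = act j f k"
    unfolding act_def
    using dvd_cong[OF d] coef_cong[OF d] periodicD[OF assms(1) e] periodicD[OF assms(1) assms(2)] by simp
qed

text \<open>The relabellings for \<open>j\<close> and \<open>opp j\<close> agree modulo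
  \<open>N\<close>, are involutions and exchange the sides \<open>j\<close> and
  \<open>opp j\<close>. Hence both maps use the same reflection up to relabelling, and they
  cancel.\<close>

lemma act_opp:
  assumes "periodic f" shows "act (opp j) (act j f) = f"
proof
  fix k
  define t where "t = k - j"
  have 1: "act (opp j) (act j f) k = act (opp j) (act j f) (opp (opp j) + t)"
    by (rule periodicD[OF periodic_act[OF periodic_act[OF assms]]]) (simp add: t_def)
  show "act (opp j) (act j f) k = f k"
  proof (cases "N dvd t")
    case True
    then have "f k = f j" using periodicD[OF assms, of k j] by (simp add: t_def)
    then show ?thesis
      unfolding 1 act_add using True act_add[of j f 0] by simp
  next
    case False
    then have "\<not> N dvd - t" by simp
    then have "act j f (opp j - t) = f (j + t) + coef t * f j"
      using act_add[of j f "- t"] by (simp add: coef_minus)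
    then show ?thesis
      unfolding 1 act_add using False act_add[of j f 0] by (simp add: t_def)
  qed
qed

section \<open>Sine quotients and the relator\<close>

text \<open>For \<open>n \<ge> 0\<close>, \<open>sq (n + 1)\<close> is the Chebyshev polynomial of
  the second kind of degree \<open>n\<close> at \<open>cos \<theta>\<close>.\<close>

definition sq :: "int \<Rightarrow> real" where "sq n = sin (of_int n * \<theta>) / sin \<theta>"

lemma \<theta>_bounds: "0 < \<theta>" "\<theta> < pi / 2"
proof -
  show "0 < \<theta>" using g2 by (simp add: \<theta>_def)
  have "pi / (2 * real g) < pi / 2" using g2 by (intro divide_strict_left_mono) auto
  then show "\<theta> < pi / 2" by (simp add: \<theta>_def)
qed

lemma sin_\<theta>_pos: "sin \<theta> > 0"
  using \<theta>_bounds by (intro sin_gt_zero) auto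

lemma cos_\<theta>_pos: "cos \<theta> > 0"
  using \<theta>_bounds by (intro cos_gt_zero_pi) auto

lemma sq_rec: "2 * cos \<theta> * sq n = sq (n + 1) + sq (n - 1)"
  unfolding sq_def using sin_\<theta>_pos
  by (simp add: field_simps sin_add sin_diff)

lemma sq_simps [simp]: "sq 0 = 0" "sq 1 = 1" "sq (- 1) = - 1"
  using sin_\<theta>_pos by (simp_all add: sq_def)

lemma sq_N: "sq (N + n) = sq n"
proof -
  have "of_int (N + n) * \<theta> = of_int n * \<theta> + 2 * pi"
    using g2 by (simp add: \<theta>_def field_simps)
  then show ?thesis by (simp add: sq_def)
qed

text \<open>Since \<open>2 * g * \<theta> = pi\<close>, the sine keeps its sign up to index
  \<open>2 * g\<close>. This makes \<open>2 * g\<close> the critical length of a run.\<close>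

lemma sq_pos: "0 < n \<Longrightarrow> n < 2 * int g \<Longrightarrow> sq n > 0"
  unfolding sq_def
proof (rule divide_pos_pos[OF sin_gt_zero sin_\<theta>_pos])
  assume n: "0 < n" "n < 2 * int g"
  show "0 < of_int n * \<theta>" using n \<theta>_bounds by simp
  have "of_int n < 2 * real g" using n by linarith
  then have "of_int n * \<theta> < 2 * real g * \<theta>" using \<theta>_bounds by simp
  also have "\<dots> = pi" using g2 by (simp add: \<theta>_def)
  finally show "of_int n * \<theta> < pi" .
qed

lemma sq_2g: "sq (2 * int g) = 0"
proof -
  have "of_int (2 * int g) * \<theta> = pi"
    using g2 by (simp add: \<theta>_def field_simps)
  then show ?thesis by (simp add: sq_def)
qed

definition acts :: "int list \<Rightarrow> (int \<Rightarrow> real) \<Rightarrow> int \<Rightarrow> real" where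
  "acts w f = foldl (\<lambda>f j. act j f) f w"

lemma acts_simps [simp]:
  "acts [] f = f" "acts (j # w) f = acts w (act j f)" "acts (u @ v) f = acts v (acts u f)"
  by (simp_all add: acts_def)

lemma periodic_acts: "periodic f \<Longrightarrow> periodic (acts w f)"
  by (induction w arbitrary: f) (auto intro: periodic_act)

lemma acts_relator:
  assumes "periodic f"
  shows "acts (map (\<lambda>i. int i * (2 * int g + 1)) [0..<4 * g]) f = f"
proof -
  \<comment> \<open>In the coordinate \<open>t\<close> relative to the moving letter \<open>s n\<close>, each step is the same operator. It
    rotates \<open>(G n 0, G n 1)\<close> by \<open>\<theta>\<close>, and the combination \<open>J\<close> of \<open>G n t\<close> with these two
    values is preserved by two steps.\<close>
  define s where "s n = int n * (2 * int g + 1)" for n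
  define F where "F n = acts (map s [0..<n]) f" for n
  \<comment> \<open>The letter \<open>s n\<close> sits at \<open>t = 1\<close>. As
    \<open>s (Suc n) - 1 = opp (s n)\<close>, the recursion for \<open>G\<close> has the same form
    for every \<open>n\<close>.\<close>
  define G where "G n t = F n (s n - 1 + t)" for n t
  have F0: "F 0 = f" and FS: "F (Suc n) = act (s n) (F n)" for n
    by (simp_all add: F_def)
  have G: "G (Suc n) t = (if N dvd t then - G n 1 else G n (1 - t) + coef t * G n 1)" for n t
  proof -
    have "s (Suc n) - 1 + t = opp (s n) + t" by (simp add: s_def algebra_simps)
    then show ?thesis unfolding G_def FS by (simp only: act_add) (simp add: algebra_simps)
  qed
  have n1: "\<not> N dvd 1" using g2 by (simp add: zdvd_not_zless)
  have c1: "coef 1 = 2 * cos \<theta>" by (simp add: coef_def)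
  have G01: "G n 0 = - (G 0 1 * sq (int n) + G 0 0 * sq (int n - 1)) \<and>
      G n 1 = G 0 1 * sq (int n + 1) + G 0 0 * sq (int n)" for n
  proof (induction n)
    case (Suc n)
    have "2 * cos \<theta> * (G 0 1 * sq (int n + 1) + G 0 0 * sq (int n)) =
        G 0 1 * (2 * cos \<theta> * sq (int n + 1)) + G 0 0 * (2 * cos \<theta> * sq (int n))"
      by (simp add: algebra_simps)
    also have "\<dots> = G 0 1 * (sq (int n + 2) + sq (int n)) + G 0 0 * (sq (int n + 1) + sq (int n - 1))"
      unfolding sq_rec by (simp add: algebra_simps)
    finally have "G (Suc n) 1 = G 0 1 * sq (int n + 2) + G 0 0 * sq (int n + 1)"
      using Suc n1 by (simp add: G c1 algebra_simps)
    then show ?case using Suc by (simp add: G algebra_simps)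
  qed simp
  have sqs: "sq (int (4 * g)) = 0" "sq (int (4 * g) - 1) = - 1" "sq (int (4 * g) + 1) = 1"
    using sq_N[of 0] sq_N[of "-1"] sq_N[of 1] by simp_all
  have end01: "G (4 * g) 0 = G 0 0" "G (4 * g) 1 = G 0 1"
    using G01[of "4 * g"] unfolding sqs by simp_all
  define D where "D = 4 - (2 * cos \<theta>)\<^sup>2"
  have "(cos \<theta>)\<^sup>2 < 1"
    using sin_\<theta>_pos sin_cos_squared_add2[of \<theta>] zero_less_power2[of "sin \<theta>"] by linarith
  then have D: "D > 0" by (simp add: D_def power_mult_distrib)
  \<comment> \<open>\<open>D\<close> is the determinant of the linear system that the next fact
    states for \<open>A t\<close> and \<open>A (1 - t)\<close>. Its solution makes
    \<open>J n t\<close> the value at the component of root \<open>t\<close> orthogonal to the roots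
    \<open>0\<close> and \<open>1\<close>, which the reflection in root \<open>1\<close>
    fixes.\<close>
  define A where "A t = (2 * coef t + 2 * cos \<theta> * coef (1 - t)) / D" for t
  have A: "2 * A t - 2 * cos \<theta> * A (1 - t) = coef t" for t
  proof -
    have "2 * A t - 2 * cos \<theta> * A (1 - t) = D * coef t / D"
      by (simp add: A_def D_def diff_divide_distrib[symmetric] algebra_simps power2_eq_square)
    then show ?thesis using D by simp
  qed
  define J where "J n t = G n t + A t * G n 0 + A (1 - t) * G n 1" for n t
  have J1: "J (Suc n) (1 - t) = J n t" if "\<not> N dvd t" "\<not> N dvd t - 1" for n t
  proof -
    have "\<not> N dvd 1 - t" using that(2) by (simp add: dvd_diff_commute)
    then have "J (Suc n) (1 - t) = G n t + A t * G n 0 +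
        (coef (1 - t) - A (1 - t) + 2 * cos \<theta> * A t) * G n 1"
      using n1 by (simp add: J_def G c1 algebra_simps)
    also have "\<dots> = J n t"
      using A[of "1 - t"] by (simp add: J_def algebra_simps)
    finally show ?thesis .
  qed
  \<comment> \<open>One step exchanges \<open>t\<close> and \<open>1 - t\<close>, so two steps
    restore the coordinate; the relator has the even length \<open>4 * g\<close>.\<close>
  have J2: "J (2 * m) t = J 0 t" if t: "\<not> N dvd t" "\<not> N dvd t - 1" for m t
  proof (induction m)
    case (Suc m)
    have "J (2 * Suc m) t = J (Suc (Suc (2 * m))) (1 - (1 - t))" by simp
    also have "\<dots> = J (Suc (2 * m)) (1 - t)"
      using t by (intro J1) (simp_all add: dvd_diff_commute)
    also have "\<dots> = J (2 * m) t" using t by (intro J1)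
    finally show ?case using Suc by simp
  qed simp
  have per: "periodic (F n)" for n using assms by (simp add: F_def periodic_acts)
  have "G (4 * g) t = G 0 t" for t
  proof (cases "N dvd t \<or> N dvd t - 1")
    case True
    have "G n t = (if N dvd t then G n 0 else G n 1)" for n
      using True unfolding G_def by (auto intro!: periodicD[OF per])
    then show ?thesis using end01 by simp
  next
    case False
    then show ?thesis using J2[of t "2 * g"] end01 by (simp add: J_def)
  qed
  then have "F (4 * g) k = f k" for k
  proof -
    have "F (4 * g) k = F (4 * g) (s (4 * g) - 1 + (k + 1))"
      by (rule periodicD[OF per]) (simp add: s_def)
    also have "\<dots> = f k"
      using \<open>\<And>t. G (4 * g) t = G 0 t\<close>[of "k + 1"] by (simp add: G_def F0 s_def)
    finally show ?thesis .
  qed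
  then have "F (4 * g) = f" by (rule ext)
  moreover have "s = (\<lambda>i. int i * (2 * int g + 1))" by (rule ext) (rule s_def)
  ultimately show ?thesis by (simp only: F_def)
qed

text \<open>The two values of \<open>e\<close> are the two directions around a polygon: each letter
  is a neighbour of the inverse of the previous one. Reduction modulo \<open>N\<close> turns being a
  factor into a relation of lists.\<close>

definition run :: "int \<Rightarrow> int \<Rightarrow> nat \<Rightarrow> int list" where
  "run j e n = map (\<lambda>i. (j + int i * (2 * int g + e)) mod N) [0..<n]"

lemma run_Suc: "run j e (Suc n) = run j e n @ [(j + int n * (2 * int g + e)) mod N]"
  by (simp add: run_def)

section \<open>Words without half-relators\<close>

text \<open>The lower bound takes \<open>m = 2 * g\<close>, the upper bound
  \<open>m = 2 * g + 1\<close>.\<close>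

definition good :: "nat \<Rightarrow> int list \<Rightarrow> bool" where
  "good m w \<longleftrightarrow> set w \<subseteq> {0..<N} \<and> successively (\<lambda>x y. y \<noteq> opp x mod N) w \<and>
     (\<forall>j. \<forall>e\<in>{1, -1}. \<not> sublist (run j e m) w)"

lemma run_nonempty: "m > 0 \<Longrightarrow> run j e m \<noteq> []"
  by (simp add: run_def)

lemma good_Nil: "m > 0 \<Longrightarrow> good m []"
  by (simp add: good_def run_nonempty)

lemma good_appendD:
  assumes "good m (u @ v)" shows "good m u" "good m v"
proof -
  have "sublist h u \<Longrightarrow> sublist h (u @ v)" "sublist h v \<Longrightarrow> sublist h (u @ v)" for h
    using sublist_append by blast+
  then have "\<forall>j. \<forall>e\<in>{1, -1}. \<not> sublist (run j e m) u" "\<forall>j. \<forall>e\<in>{1, -1}. \<not> sublist (run j e m) v"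
    using assms unfolding good_def by blast+
  then show "good m u" "good m v"
    using assms by (simp_all add: good_def successively_append_iff)
qed

text \<open>A violation that is new after appending a letter must involve that letter, hence lie at
  the end.\<close>

lemma good_snoc:
  "good m (w @ [y]) \<longleftrightarrow> good m w \<and> 0 \<le> y \<and> y < N \<and> (w \<noteq> [] \<longrightarrow> y \<noteq> opp (last w) mod N) \<and>
     (\<forall>j. \<forall>e\<in>{1, -1}. \<not> suffix (run j e m) (w @ [y]))" (is "?L \<longleftrightarrow> ?R")
proof
  assume L: ?L
  then have "\<forall>j. \<forall>e\<in>{1, -1}. \<not> suffix (run j e m) (w @ [y])"
    unfolding good_def using suffix_imp_sublist by blast
  moreover have "0 \<le> y" "y < N" "w \<noteq> [] \<longrightarrow> y \<noteq> opp (last w) mod N"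
    using L by (auto simp: good_def successively_append_iff)
  ultimately show ?R using good_appendD(1)[OF L] by blast
next
  have sub: "sublist h (w @ [y]) \<longleftrightarrow> sublist h w \<or> suffix h (w @ [y])" for h
  proof
    assume "sublist h (w @ [y])"
    then obtain p q where pq: "w @ [y] = p @ h @ q" by (auto simp: sublist_def)
    show "sublist h w \<or> suffix h (w @ [y])"
    proof (cases q rule: rev_cases)
      case Nil then show ?thesis using pq by (auto simp: suffix_def)
    next
      case (snoc q' z) then show ?thesis using pq by (auto simp: sublist_def)
    qed
  qed (use sublist_append suffix_imp_sublist in blast)
  assume ?R
  then show ?L unfolding good_def sub by (auto simp: successively_append_iff)
qed

text \<open>The constant functional is positive at all simple roots, so it lies inside the
  fundamental chamber, where Tits' argument starts.\<close>

definition height :: "int list \<Rightarrow> int \<Rightarrow> real" where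
  "height w = acts w (\<lambda>_. 1)"

lemma periodic_height: "periodic (height w)"
  unfolding height_def by (rule periodic_acts) (simp add: periodic_def)

lemma height_snoc: "height (w @ [y]) = act y (height w)"
  by (simp add: height_def)

definition adjacent :: "int \<Rightarrow> bool" where
  "adjacent t \<longleftrightarrow> N dvd t - 1 \<or> N dvd t + 1"

lemma coef_adj: "coef t = (if adjacent t then 2 * cos \<theta> else 2)"
  by (simp add: coef_def adjacent_def)

lemma coef_pos: "coef t > 0"
  using cos_\<theta>_pos by (simp add: coef_def)

lemma adjacent_cong: "N dvd a - b \<Longrightarrow> adjacent a \<longleftrightarrow> adjacent b"
  unfolding adjacent_def
  using dvd_cong[of "a - 1" "b - 1"] dvd_cong[of "a + 1" "b + 1"] by simp

lemma not_dvd_unit: "e \<in> {1, -1} \<Longrightarrow> \<not> N dvd e"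
  using g2 by (auto simp: zdvd_not_zless)

text \<open>
  The reflections in two adjacent sides act on the pair of their heights by rotations, so after a run
  of length \<open>p\<close> these heights are explicit in their positive values \<open>\<alpha>\<close>, \<open>\<beta>\<close> before the run.
\<close>

definition run_shape :: "int list \<Rightarrow> real \<Rightarrow> real \<Rightarrow> int \<Rightarrow> bool" where
  "run_shape w a b e \<longleftrightarrow> (\<exists>p j \<alpha> \<beta>. 1 \<le> p \<and> p < 2 * g \<and> suffix (run j e p) w \<and> \<alpha> > 0 \<and> \<beta> > 0 \<and>
     a = - (\<alpha> * sq (int p) + \<beta> * sq (int p - 1)) \<and> b = \<alpha> * sq (int p + 1) + \<beta> * sq (int p))"

text \<open>For a run of length \<open>1\<close> the parameters \<alpha> and \<beta> are the old
  heights themselves, as \<open>sq 0 = 0\<close> and \<open>sq 1 = 1\<close>.\<close>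

lemma run_shape_single:
  assumes "a > 0" "b > 0" "0 \<le> y" "y < N"
  shows "run_shape (w @ [y]) (- a) (b + 2 * cos \<theta> * a) e"
proof -
  have "suffix (run y e 1) (w @ [y])" using assms by (simp add: run_def)
  moreover have "sq (int 1 + 1) = 2 * cos \<theta>" using sq_rec[of 1] by simp
  ultimately show ?thesis
    unfolding run_shape_def using g2 assms
    by (intro exI[of _ 1] exI[of _ y] exI[of _ a] exI[of _ b]) simp
qed

text \<open>By \<open>sq_rec\<close>, prolonging a run raises all indices of \<open>sq\<close> by
  one. Goodness keeps these indices within the range where \<open>sq\<close> is not
  negative.\<close>

lemma run_shape_step:
  assumes s: "run_shape w a b e" and y: "y = (opp (last w) + e) mod N"
    and good: "good (2 * g) (w @ [y])" and e: "e \<in> {1, -1}"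
  shows "a + 2 * cos \<theta> * b > 0" "run_shape (w @ [y]) (- b) (a + 2 * cos \<theta> * b) e"
proof -
  from s obtain p j \<alpha> \<beta> where p: "1 \<le> p" "p < 2 * g" and suf: "suffix (run j e p) w"
    and ab: "\<alpha> > 0" "\<beta> > 0" "a = - (\<alpha> * sq (int p) + \<beta> * sq (int p - 1))"
      "b = \<alpha> * sq (int p + 1) + \<beta> * sq (int p)"
    unfolding run_shape_def by blast
  from p obtain q where q: "p = Suc q" by (cases p) auto
  have "last w = (j + int q * (2 * int g + e)) mod N"
    using suf unfolding q run_Suc by (auto simp: suffix_def)
  then have "y = ((j + int q * (2 * int g + e)) mod N + (2 * int g + e)) mod N"
    unfolding y by (simp add: add.assoc)
  also have "\<dots> = (j + int p * (2 * int g + e)) mod N"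
    unfolding mod_add_left_eq q by (simp add: algebra_simps)
  finally have "y = (j + int p * (2 * int g + e)) mod N" .
  then have suf': "suffix (run j e (Suc p)) (w @ [y])"
    using suf by (auto simp: run_Suc suffix_def)
  \<comment> \<open>A run of length exactly \<open>2 * g\<close> at the end is forbidden.\<close>
  have p': "Suc p < 2 * g"
    using good suf' e p by (cases "Suc p = 2 * g") (auto simp: good_snoc)
  have "2 * cos \<theta> * b = \<alpha> * (2 * cos \<theta> * sq (int p + 1)) + \<beta> * (2 * cos \<theta> * sq (int p))"
    by (simp add: ab algebra_simps)
  also have "\<dots> = \<alpha> * (sq (int p + 2) + sq (int p)) + \<beta> * (sq (int p + 1) + sq (int p - 1))"
    unfolding sq_rec by (simp add: algebra_simps)
  finally have eq: "a + 2 * cos \<theta> * b = \<alpha> * sq (int p + 2) + \<beta> * sq (int p + 1)"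
    by (simp add: ab algebra_simps)
  \<comment> \<open>The index may reach \<open>2 * g\<close>, where \<open>sq\<close> vanishes;
    strict positivity then comes from the summand with \<beta>.\<close>
  have "sq (int p + 2) \<ge> 0"
  proof (cases "int p + 2 = 2 * int g")
    case True then show ?thesis using sq_2g by simp
  next
    case False then show ?thesis using p' by (intro less_imp_le sq_pos) auto
  qed
  moreover have "sq (int p + 1) > 0" using p' by (intro sq_pos) auto
  ultimately show "a + 2 * cos \<theta> * b > 0"
    unfolding eq using ab by (intro add_nonneg_pos) auto
  show "run_shape (w @ [y]) (- b) (a + 2 * cos \<theta> * b) e"
    unfolding run_shape_def eq using p' suf' ab
    by (intro exI[of _ "Suc p"] exI[of _ j] exI[of _ \<alpha>] exI[of _ \<beta>]) (simp add: algebra_simps)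
qed

text \<open>Only the first two clauses, the sign pattern, are wanted; the other two close the
  induction. A new height away from the negative side is an old one plus a positive multiple of the
  positive height at the new letter, so only the old negative height is a danger. The third clause
  outweighs it at sides that are not adjacent, \<open>run_shape_step\<close> at adjacent
  ones.\<close>

lemma height_invariant:
  assumes "good (2 * g) (w @ [x])"
  shows "height (w @ [x]) (opp x) < 0 \<and>
    (\<forall>t. \<not> N dvd t \<longrightarrow> height (w @ [x]) (opp x + t) > 0) \<and>
    (\<forall>t. \<not> N dvd t \<longrightarrow> \<not> adjacent t \<longrightarrow> height (w @ [x]) (opp x) + height (w @ [x]) (opp x + t) > 0) \<and>
    (\<forall>e\<in>{1, -1}. run_shape (w @ [x]) (height (w @ [x]) (opp x)) (height (w @ [x]) (opp x + e)) e)"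
  using assms
proof (induction w arbitrary: x rule: rev_induct)
  case Nil
  have f: "height [x] (opp x + t) = (if N dvd t then - 1 else 1 + coef t)" for t
    by (simp add: height_def act_add)
  have rs: "run_shape [x] (- 1) (1 + 2 * cos \<theta>) e" for e
    using run_shape_single[of 1 1 x "[]" e] Nil by (simp add: good_def)
  have "height [x] (opp x) = - 1" using f[of 0] by simp
  moreover have "height [x] (opp x + t) > 0" if "\<not> N dvd t" for t
    using that coef_pos[of t] by (simp add: f)
  moreover have "height [x] (opp x + t) = 3" if "\<not> N dvd t" "\<not> adjacent t" for t
    using that by (simp add: f coef_adj)
  moreover have "height [x] (opp x + e) = 1 + 2 * cos \<theta>" if "e \<in> {1, -1}" for e
    using f[of e] not_dvd_unit[OF that] that by (auto simp: coef_def)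
  ultimately show ?case using rs by simp
next
  case (snoc z w y)
  define f' where "f' = height ((w @ [z]) @ [y])"
  define i' where "i' = opp y"
  define f where "f = height (w @ [z])"
  define i where "i = opp z"
  have good: "good (2 * g) (w @ [z])" using snoc.prems good_appendD by blast
  have IH: "f i < 0" "\<And>t. \<not> N dvd t \<Longrightarrow> f (i + t) > 0"
    "\<And>t. \<not> N dvd t \<Longrightarrow> \<not> adjacent t \<Longrightarrow> f i + f (i + t) > 0"
    "\<And>e. e \<in> {1, -1} \<Longrightarrow> run_shape (w @ [z]) (f i) (f (i + e)) e"
    using snoc.IH[OF good] unfolding f_def i_def by blast+
  have per: "periodic f" by (simp add: f_def periodic_height)
  define s where "s = y - i"
  have y: "0 \<le> y" "y < N" "y \<noteq> opp z mod N"
    using snoc.prems good_snoc[of "2 * g" "w @ [z]" y] by auto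
  have s: "\<not> N dvd s"
  proof
    assume "N dvd s"
    then have "y mod N = opp z mod N" by (simp add: s_def i_def mod_eq_dvd_iff)
    with y show False by simp
  qed
  have fy: "f y > 0" using IH(2)[OF s] by (simp add: s_def)
  have f': "f' (i' + t) = (if N dvd t then - f y else f (y - t) + coef t * f y)" for t
    unfolding i'_def f'_def f_def height_snoc[of "w @ [z]"] by (rule act_add)
  have fyt: "f (y - t) > 0" if "\<not> N dvd s - t" for t
    using IH(2)[OF that] by (simp add: s_def)
  have fyi: "f (y - t) = f i" if "N dvd s - t" for t
    by (rule periodicD[OF per]) (use that in \<open>simp add: s_def algebra_simps\<close>)
  have step: "run_shape (w @ [z]) (f i) (f y) e" "y = (opp (last (w @ [z])) + e) mod N"
    if "e \<in> {1, -1}" "N dvd s - e" for e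
  proof -
    have "f y = f (i + e)" by (rule periodicD[OF per]) (use that in \<open>simp add: s_def algebra_simps\<close>)
    then show "run_shape (w @ [z]) (f i) (f y) e" using IH(4)[OF that(1)] by simp
    have "y mod N = (i + e) mod N" using that(2) by (simp add: mod_eq_dvd_iff s_def algebra_simps)
    then show "y = (opp (last (w @ [z])) + e) mod N" using y by (simp add: i_def)
  qed
  \<comment> \<open>The case \<open>N dvd s - t\<close> says that the old negative side
    \<open>i\<close> is relabelled to \<open>i' + t\<close>.\<close>
  have pos: "f' (i' + t) > 0" if t: "\<not> N dvd t" for t
  proof (cases "N dvd s - t")
    case False
    then show ?thesis using f'[of t] t fyt[of t] fy coef_pos[of t] by (simp add: add_pos_pos)
  next
    case True
    show ?thesis
    proof (cases "adjacent t")
      case False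
      then have "f i + f y > 0"
        using IH(3)[OF s] adjacent_cong[OF True] by (simp add: s_def)
      then show ?thesis using f'[of t] t False fyi[OF True] fy by (simp add: coef_adj)
    next
      case adj: True
      then have "N dvd t - 1 \<or> N dvd t - (- 1)" by (simp add: adjacent_def)
      then obtain e where e: "e \<in> {1, -1}" "N dvd t - e" by blast
      \<comment> \<open>So \<open>y\<close> is the neighbour of \<open>opp z\<close> in direction
        \<open>e\<close>, and it prolongs a run.\<close>
      have se: "N dvd s - e" using dvd_add[OF True e(2)] by simp
      show ?thesis
        using run_shape_step(1)[OF step[OF e(1) se] snoc.prems e(1)] f'[of t] t adj fyi[OF True]
        by (simp add: coef_adj)
    qed
  qed
  \<comment> \<open>The coefficient \<open>2\<close> absorbs the summand \<open>- f y\<close> and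
    leaves one copy of \<open>f y\<close>.\<close>
  have sum: "f' i' + f' (i' + t) > 0" if t: "\<not> N dvd t" "\<not> adjacent t" for t
  proof -
    have "f' i' + f' (i' + t) = f (y - t) + f y"
      using f'[of 0] f'[of t] t by (simp add: coef_adj)
    moreover have "f (y - t) + f y > 0"
    proof (cases "N dvd s - t")
      case False then show ?thesis using fyt fy by (simp add: add_pos_pos)
    next
      case True
      then have "\<not> adjacent s" using adjacent_cong[OF True] t by simp
      then show ?thesis using IH(3)[OF s] fyi[OF True] by (simp add: s_def)
    qed
    ultimately show ?thesis by simp
  qed
  \<comment> \<open>The neighbour of \<open>opp z\<close> in direction \<open>e\<close> prolongs the
    run in that direction; any other letter restarts it at length \<open>1\<close>.\<close>
  have rs: "run_shape ((w @ [z]) @ [y]) (f' i') (f' (i' + e)) e" if e: "e \<in> {1, -1}" for e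
  proof -
    have fe: "f' i' = - f y" "f' (i' + e) = f (y - e) + 2 * cos \<theta> * f y"
      using f'[of 0] f'[of e] not_dvd_unit[OF e] e by (auto simp: coef_def)
    show ?thesis
    proof (cases "N dvd s - e")
      case True
      show ?thesis
        unfolding fe fyi[OF True] using run_shape_step(2)[OF step[OF e True] snoc.prems e] .
    next
      case False
      show ?thesis
        unfolding fe by (rule run_shape_single[OF fy fyt[OF False] y(1,2)])
    qed
  qed
  have "f' i' < 0" using f'[of 0] fy by simp
  then show ?case using pos sum rs unfolding f'_def i'_def by blast
qed

text \<open>The only negative height marks the last letter, which \<open>act_opp\<close> then strips
  off. The empty word has no negative height.\<close>

lemma height_inj:
  assumes "good (2 * g) u" "good (2 * g) v" "height u = height v"
  shows "u = v"
  using assms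
proof (induction u arbitrary: v rule: rev_induct)
  case Nil
  show ?case
  proof (cases v rule: rev_cases)
    case (snoc v' y)
    then have "height v (opp y) < 0" using height_invariant Nil.prems(2) by blast
    moreover have "height v (opp y) = 1" using Nil.prems(3) by (simp flip: Nil.prems(3)) (simp add: height_def)
    ultimately show ?thesis by simp
  qed simp
next
  case (snoc x u)
  have neg: "height (u @ [x]) (opp x) < 0" using height_invariant snoc.prems(1) by blast
  obtain v' y where v: "v = v' @ [y]"
  proof (cases v rule: rev_cases)
    case Nil
    then have "height (u @ [x]) (opp x) = 1" using snoc.prems(3) by (simp add: height_def)
    with neg show ?thesis by simp
  qed auto
  have "N dvd x - y"
  proof (rule ccontr)
    assume "\<not> N dvd x - y"
    then have "height v (opp y + (x - y)) > 0"
      using height_invariant[of v' y] snoc.prems(2) unfolding v by blast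
    then show False using neg snoc.prems(3) by (simp add: algebra_simps)
  qed
  then have "x mod N = y mod N" by (simp add: mod_eq_dvd_iff)
  then have xy: "x = y" using snoc.prems unfolding v by (auto simp: good_snoc)
  have "act (opp x) (act x (height u)) = act (opp x) (act x (height v'))"
    using snoc.prems(3) by (simp add: v xy height_snoc)
  then have "height u = height v'" by (simp add: act_opp periodic_height)
  moreover have "good (2 * g) u" "good (2 * g) v'"
    using snoc.prems good_appendD unfolding v by blast+
  ultimately show ?case using snoc.IH v xy by blast
qed

section \<open>The letters of the surface group\<close>

abbreviation weq :: "nat word \<Rightarrow> nat word \<Rightarrow> bool" where
  "weq \<equiv> word_eq {1..2 * g} {surface_relator g}"

abbreviation Words :: "nat word set" where
  "Words \<equiv> words {1..2 * g}"

text \<open>Around a vertex the edges \<open>c\<^sub>1, c\<^sub>2\<^sup>-\<^sup>1, c\<^sub>3, \<dots>, c\<^sub>2\<^sub>g\<^sup>-\<^sup>1\<close> are followed by their inverses, so the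
  orientation alternates with the index.\<close>

definition letter :: "int \<Rightarrow> nat \<times> bool" where
  "letter p = (nat (p mod (2 * int g)) + 1, even p \<longleftrightarrow> p mod N < 2 * int g)"

definition index :: "nat \<times> bool \<Rightarrow> int" where
  "index l = int (fst l) - 1 + (if snd l \<longleftrightarrow> odd (fst l) then 0 else 2 * int g)"

lemma letter_cong:
  assumes "N dvd p - q" shows "letter p = letter q"
proof -
  have "2 * int g dvd p - q" "2 dvd p - q"
    by (rule dvd_trans[OF _ assms]; simp)+
  then have "p mod (2 * int g) = q mod (2 * int g)" "even p \<longleftrightarrow> even q"
    by (auto simp: mod_eq_dvd_iff)
  moreover have "p mod N = q mod N" using assms by (simp add: mod_eq_dvd_iff)
  ultimately show ?thesis by (simp add: letter_def)
qed

lemma letter_mod: "letter (p mod N) = letter p"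
  by (rule letter_cong) (simp add: mod_eq_dvd_iff[symmetric])

lemma letter_small:
  assumes "0 \<le> p" "p < 2 * int g"
  shows "letter p = (nat p + 1, even p)" "letter (opp p) = (nat p + 1, odd p)"
  using assms by (simp_all add: letter_def)

lemma letter_cases:
  obtains q where "0 \<le> q" "q < 2 * int g" "N dvd p - q \<or> N dvd p - opp q"
proof (cases "p mod N < 2 * int g")
  case True
  then show ?thesis using that[of "p mod N"] g2 by (simp add: mod_eq_dvd_iff[symmetric])
next
  case False
  have "p mod N < N" using g2 by simp
  then show ?thesis using that[of "p mod N - 2 * int g"] False by (simp add: mod_eq_dvd_iff[symmetric])
qed

lemma fst_letter: "fst (letter p) \<in> {1..2 * g}"
proof -
  have "0 \<le> p mod (2 * int g)" "p mod (2 * int g) < 2 * int g" using g2 by simp_all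
  then have "nat (p mod (2 * int g)) < 2 * g" by linarith
  then show ?thesis by (simp add: letter_def)
qed

lemma letter_opp: "letter (opp p) = (fst (letter p), \<not> snd (letter p))"
proof -
  obtain q where q: "0 \<le> q" "q < 2 * int g" "N dvd p - q \<or> N dvd p - opp q"
    by (rule letter_cases)
  from q(3) show ?thesis
  proof
    assume "N dvd p - q"
    then have "letter p = letter q" "letter (opp p) = letter (opp q)"
      by (auto intro!: letter_cong)
    then show ?thesis using letter_small[OF q(1,2)] by simp
  next
    assume d: "N dvd p - opp q"
    have "opp p - q = (p - opp q) + N" by simp
    then have "N dvd opp p - q" using dvd_add[OF d dvd_refl] by argo
    then have "letter p = letter (opp q)" "letter (opp p) = letter q"
      using d by (auto intro!: letter_cong)
    then show ?thesis using letter_small[OF q(1,2)] by simp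
  qed
qed

lemma letter_index:
  assumes "fst l \<in> {1..2 * g}" shows "letter (index l) = l"
proof -
  define q where "q = int (fst l) - 1"
  have q: "0 \<le> q" "q < 2 * int g" "nat q + 1 = fst l" "even q \<longleftrightarrow> odd (fst l)"
    using assms by (auto simp: q_def)
  have "index l = (if snd l \<longleftrightarrow> odd (fst l) then q else opp q)" by (simp add: index_def q_def)
  then show ?thesis using letter_small[OF q(1,2)] q(3,4) by (cases l) auto
qed

lemma index_letter: "N dvd index (letter p) - p"
proof -
  obtain q where q: "0 \<le> q" "q < 2 * int g" "N dvd p - q \<or> N dvd p - opp q"
    by (rule letter_cases)
  have "index (letter q) = q" "index (letter (opp q)) = opp q"
    unfolding letter_small[OF q(1,2)] using q by (auto simp: index_def even_nat_iff)
  then show ?thesis using q(3) letter_cong by (metis dvd_diff_commute)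
qed

lemma index_flip: "fst l \<in> {1..2 * g} \<Longrightarrow> N dvd index (fst l, \<not> snd l) - opp (index l)"
  using index_letter[of "opp (index l)"] by (simp add: letter_opp letter_index)

lemma map_letter_Words: "map letter w \<in> Words"
  using fst_letter by (induction w) simp_all

lemma acts_index_letter: "periodic f \<Longrightarrow> acts (map index (map letter w)) f = acts w f"
proof (induction w arbitrary: f)
  case (Cons p w)
  then show ?case using act_cong[OF Cons.prems index_letter] periodic_act by simp
qed simp

text \<open>Modulo \<open>N\<close>, \<open>i * (2 * g + 1)\<close> is \<open>i\<close> for even
  \<open>i\<close> and \<open>opp i\<close> for odd \<open>i\<close>. This flip compensates the
  alternating orientation in \<open>letter\<close>.\<close>

lemma letter_relator:
  "map letter (map (\<lambda>i. int i * (2 * int g + 1)) [0..<4 * g]) = surface_relator g"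
proof (rule nth_equalityI)
  show len: "length (map letter (map (\<lambda>i. int i * (2 * int g + 1)) [0..<4 * g])) = length (surface_relator g)"
    by (simp add: surface_relator_def)
  fix i assume "i < length (map letter (map (\<lambda>i. int i * (2 * int g + 1)) [0..<4 * g]))"
  then have i: "i < 4 * g" by simp
  have *: "letter (int i * (2 * int g + 1)) = (if even i then letter (int i) else letter (opp (int i)))"
  proof (cases "even i")
    case True
    then obtain k where "i = 2 * k" by (rule evenE)
    then have "N dvd int i * (2 * int g + 1) - int i" by (simp add: algebra_simps)
    then show ?thesis using True letter_cong by simp
  next
    case False
    then obtain k where "i = 2 * k + 1" by (rule oddE)
    then have "N dvd int i * (2 * int g + 1) - opp (int i)" by (simp add: algebra_simps)
    then show ?thesis using False letter_cong by simp
  qed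
  show "map letter (map (\<lambda>i. int i * (2 * int g + 1)) [0..<4 * g]) ! i = surface_relator g ! i"
  proof (cases "i < 2 * g")
    case True
    then show ?thesis
      using * letter_small[of "int i"] i by (simp add: surface_relator_def nth_append del: upt_Suc)
  next
    case False
    define q where "q = i - 2 * g"
    have q: "q < 2 * g" "i = q + 2 * g" using False i by (auto simp: q_def)
    have "letter (opp (opp (int q))) = letter (int q)" by (rule letter_cong) simp
    then show ?thesis
      using * letter_small[of "int q"] q by (simp add: surface_relator_def nth_append add.commute del: upt_Suc)
  qed
qed

lemma acts_surface_relator:
  assumes "periodic f" shows "acts (map index (surface_relator g)) f = f"
  using acts_index_letter[OF assms, of "map (\<lambda>i. int i * (2 * int g + 1)) [0..<4 * g]"]
    acts_relator[OF assms] unfolding letter_relator by simp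

text \<open>The action thus factors through the group: \<open>act_opp\<close> handles cancellation
  and \<open>acts_relator\<close> the relator.\<close>

lemma acts_weq:
  assumes "weq u v" "periodic f" shows "acts (map index u) f = acts (map index v) f"
  using assms
proof (induction arbitrary: f rule: word_eq.induct)
  case (cancel u v x b)
  have x: "fst (x, b) \<in> {1..2 * g}" using cancel by simp
  have "act (index (x, \<not> b)) (act (index (x, b)) h) = h" if "periodic h" for h
    using act_cong[OF periodic_act[OF that] index_flip[OF x]] act_opp[OF that] by simp
  then show ?case using cancel.prems periodic_acts by simp
next
  case (relator u v r)
  then show ?case using acts_surface_relator periodic_acts by simp
qed simp_all

definition eqv :: "int list \<Rightarrow> int list \<Rightarrow> bool" where
  "eqv u v \<longleftrightarrow> weq (map letter u) (map letter v)"

lemma eqv_refl: "eqv u u"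
  unfolding eqv_def by (rule word_eq.refl[OF map_letter_Words])

lemma eqv_sym: "eqv u v \<Longrightarrow> eqv v u"
  unfolding eqv_def by (rule word_eq.sym)

lemma eqv_trans [trans]: "eqv u v \<Longrightarrow> eqv v w \<Longrightarrow> eqv u w"
  unfolding eqv_def by (rule word_eq.trans)

lemma eqv_append: "eqv u u' \<Longrightarrow> eqv v v' \<Longrightarrow> eqv (u @ v) (u' @ v')"
  unfolding eqv_def map_append by (rule word_eq_append)

definition inverse_word :: "int list \<Rightarrow> int list" where
  "inverse_word w = rev (map (\<lambda>p. opp p) w)"

lemma letter_inverse_word: "map letter (inverse_word w) = inv_word (map letter w)"
  by (simp add: inverse_word_def inv_word_def rev_map letter_opp split_beta)

lemma eqv_inverse_left: "eqv (inverse_word w @ w) []"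
  using inv_word_left[OF map_letter_Words] by (simp add: eqv_def letter_inverse_word)

lemma eqv_inverse_right: "eqv (w @ inverse_word w) []"
proof -
  have "map letter (inverse_word (inverse_word w)) = map letter w"
    by (simp add: letter_inverse_word inv_word_def rev_map split_beta o_def)
  then show ?thesis using eqv_inverse_left[of "inverse_word w"] by (simp add: eqv_def)
qed

text \<open>\<open>v @ u\<close> represents the conjugate of \<open>u @ v\<close> by
  \<open>v\<close>.\<close>

lemma eqv_rotate:
  assumes "eqv (u @ v) []" shows "eqv (v @ u) []"
proof -
  have "eqv ((v @ u) @ []) ((v @ u) @ (v @ inverse_word v))"
    by (rule eqv_append[OF eqv_refl eqv_sym[OF eqv_inverse_right]])
  also have "eqv ((v @ u) @ (v @ inverse_word v)) (v @ [] @ inverse_word v)"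
    using eqv_append[OF eqv_refl eqv_append[OF assms eqv_refl], of v "inverse_word v"] by simp
  also have "eqv (v @ [] @ inverse_word v) []" using eqv_inverse_right by simp
  finally show ?thesis by simp
qed

lemma eqv_inverse:
  assumes "eqv (u @ v) []" shows "eqv u (inverse_word v)"
proof -
  have "eqv (u @ []) (u @ (v @ inverse_word v))"
    by (rule eqv_append[OF eqv_refl eqv_sym[OF eqv_inverse_right]])
  also have "eqv (u @ (v @ inverse_word v)) ([] @ inverse_word v)"
    using eqv_append[OF assms eqv_refl, of "inverse_word v"] by simp
  finally show ?thesis by simp
qed

section \<open>Runs as factors of relators\<close>

lemma run_append: "run j e (m + n) = run j e m @ run (j + int m * (2 * int g + e)) e n"
proof -
  have "map (\<lambda>i. (j + int i * (2 * int g + e)) mod N) [m..<m + n] =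
      map (\<lambda>i. (j + int m * (2 * int g + e) + int i * (2 * int g + e)) mod N) [0..<n]"
    by (rule nth_equalityI) (simp_all add: algebra_simps)
  then show ?thesis by (simp add: run_def upt_add_eq_append[of 0 m n])
qed

lemma run_cong: "N dvd i - j \<Longrightarrow> run i e n = run j e n"
  by (simp add: run_def mod_eq_dvd_iff)

lemma length_run [simp]: "length (run j e n) = n"
  by (simp add: run_def)

lemma map_letter_run: "map letter (run j e n) = map (\<lambda>i. letter (j + int i * (2 * int g + e))) [0..<n]"
  by (simp add: run_def letter_mod)

text \<open>Every full run is a cyclic rotation of the one from \<open>0\<close>, which spells the
  relator.\<close>

lemma eqv_run_pos: "eqv (run j 1 (4 * g)) []"
proof -
  \<comment> \<open>The position of letter \<open>j\<close> in the run from \<open>0\<close>: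
    \<open>2 * g + 1\<close> is its own inverse modulo \<open>N\<close>, as its square is
    \<open>N * (g + 1) + 1\<close>.\<close>
  define k where "k = nat (j * (2 * int g + 1) mod N)"
  have "0 \<le> j * (2 * int g + 1) mod N" "j * (2 * int g + 1) mod N < N" using g2 by auto
  then have k: "k < 4 * g" "int k = j * (2 * int g + 1) mod N" by (auto simp: k_def)
  have "map letter (run 0 1 (4 * g)) = surface_relator g"
    unfolding letter_relator[symmetric] map_letter_run by (simp add: o_def)
  moreover have "surface_relator g \<in> Words"
    unfolding letter_relator[symmetric] by (rule map_letter_Words)
  ultimately have "eqv (run 0 1 (4 * g)) []"
    using word_eq.relator[of "[]" "{1..2 * g}" "[]" "surface_relator g" "{surface_relator g}"]
    by (simp add: eqv_def)
  moreover have "run 0 1 (4 * g) = run 0 1 k @ run (int k * (2 * int g + 1)) 1 (4 * g - k)"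
    using run_append[of 0 1 k "4 * g - k"] k by simp
  ultimately have "eqv (run (int k * (2 * int g + 1)) 1 (4 * g - k) @ run 0 1 k) []"
    using eqv_rotate by simp
  moreover have "run (int k * (2 * int g + 1)) 1 (4 * g) =
    run (int k * (2 * int g + 1)) 1 (4 * g - k) @ run 0 1 k"
  proof -
    have "int k * (2 * int g + 1) + int (4 * g - k) * (2 * int g + 1) = N * (2 * int g + 1)"
      using k by (simp add: of_nat_diff algebra_simps)
    then have "run (int k * (2 * int g + 1) + int (4 * g - k) * (2 * int g + 1)) 1 k = run 0 1 k"
      by (intro run_cong) simp
    then show ?thesis
      using run_append[of "int k * (2 * int g + 1)" 1 "4 * g - k" k] k by simp
  qed
  moreover have "run (int k * (2 * int g + 1)) 1 (4 * g) = run j 1 (4 * g)"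
  proof (rule run_cong)
    have "N dvd int k - j * (2 * int g + 1)"
      unfolding k(2) by (simp add: mod_eq_dvd_iff[symmetric])
    then have "N dvd (int k - j * (2 * int g + 1)) * (2 * int g + 1) + N * (j * (int g + 1))"
      by simp
    also have "(int k - j * (2 * int g + 1)) * (2 * int g + 1) + N * (j * (int g + 1)) =
        int k * (2 * int g + 1) - j"
      by (simp add: algebra_simps)
    finally show "N dvd int k * (2 * int g + 1) - j" .
  qed
  ultimately show ?thesis by simp
qed

lemma eqv_run:
  assumes "e \<in> {1, -1}" shows "eqv (run j e (4 * g)) []"
proof (cases "e = 1")
  case False
  then have e: "e = -1" using assms by simp
  \<comment> \<open>Going around backwards inverts a forward run. That run starts at
    \<open>j + 1\<close> because its last letter is then \<open>opp j\<close> modulo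
    \<open>N\<close>, whose inverse is \<open>j\<close>.\<close>
  have "map letter (run j (-1) (4 * g)) = map letter (inverse_word (run (j + 1) 1 (4 * g)))"
  proof (rule nth_equalityI)
    fix i assume "i < length (map letter (run j (-1) (4 * g)))"
    then have i: "i < 4 * g" by simp
    then have ii: "int (4 * g - Suc i) = 4 * int g - 1 - int i" by simp
    have "map letter (inverse_word (run (j + 1) 1 (4 * g))) ! i =
        letter (opp ((j + 1 + int (4 * g - Suc i) * (2 * int g + 1)) mod N))"
      using i by (simp add: inverse_word_def rev_nth run_def)
    also have "\<dots> = letter (opp (j + 1 + int (4 * g - Suc i) * (2 * int g + 1)))"
      by (simp add: letter_opp letter_mod)
    also have "\<dots> = letter (j + int i * (2 * int g - 1))"
    proof (rule letter_cong)
      have "opp (j + 1 + int (4 * g - Suc i) * (2 * int g + 1)) - (j + int i * (2 * int g - 1)) =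
          N * (2 * int g + 1 - int i)"
        unfolding ii by (simp add: algebra_simps)
      then show "N dvd opp (j + 1 + int (4 * g - Suc i) * (2 * int g + 1)) - (j + int i * (2 * int g - 1))"
        by simp
    qed
    finally show "map letter (run j (-1) (4 * g)) ! i =
        map letter (inverse_word (run (j + 1) 1 (4 * g))) ! i"
      using i by (simp add: run_def letter_mod)
  qed (simp add: inverse_word_def)
  moreover have "eqv (inverse_word (run (j + 1) 1 (4 * g))) []"
  proof -
    have "eqv (inverse_word (run (j + 1) 1 (4 * g)) @ []) (inverse_word (run (j + 1) 1 (4 * g)) @ run (j + 1) 1 (4 * g))"
      by (rule eqv_append[OF eqv_refl eqv_sym[OF eqv_run_pos]])
    also have "eqv \<dots> []" by (rule eqv_inverse_left)
    finally show ?thesis by simp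
  qed
  ultimately show ?thesis by (simp add: e eqv_def)
qed (simp add: eqv_run_pos)

text \<open>The rest of the relator has only \<open>2 * g - 1\<close> letters, and its inverse
  replaces the run.\<close>

lemma run_shortens:
  assumes "e \<in> {1, -1}"
  obtains v where "eqv (run j e (2 * g + 1)) v" "length v < 2 * g + 1"
proof
  define v where "v = run (j + int (2 * g + 1) * (2 * int g + e)) e (2 * g - 1)"
  have "2 * g + 1 + (2 * g - 1) = 4 * g" using g2 by simp
  then have "run j e (4 * g) = run j e (2 * g + 1) @ v"
    unfolding v_def using run_append[of j e "2 * g + 1" "2 * g - 1"] by simp
  then show "eqv (run j e (2 * g + 1)) (inverse_word v)"
    using eqv_run[OF assms, of j] by (intro eqv_inverse) simp
  show "length (inverse_word v) < 2 * g + 1" by (simp add: v_def inverse_word_def)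
qed

section \<open>Balls and good words\<close>

definition good_words :: "nat \<Rightarrow> nat \<Rightarrow> int list set" where
  "good_words m n = {w. good m w \<and> length w = n}"

lemma finite_good_words: "finite (good_words m n)"
  by (rule finite_subset[OF _ finite_lists_length_eq[of "{0..<N}" n]])
    (auto simp: good_words_def good_def)

abbreviation ball :: "nat \<Rightarrow> nat word set set" where
  "ball n \<equiv> {x \<in> carrier (surface_group g). word_length (surface_group g) (surface_gens g) x \<le> n}"

definition group_elem :: "int list \<Rightarrow> nat word set" where
  "group_elem w = word_rel {1..2 * g} {surface_relator g} `` {map letter w}"

lemma group_elem_in_ball: "length w \<le> n \<Longrightarrow> group_elem w \<in> ball n"
proof -
  assume n: "length w \<le> n"
  have "word_length (surface_group g) (surface_gens g) (group_elem w) =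
      (LEAST n. \<exists>u\<in>Words. length u = n \<and> weq u (map letter w))"
    unfolding surface_group_def surface_gens_def group_elem_def
    by (rule word_length_word_class[OF map_letter_Words])
  also have "\<dots> \<le> length w"
    using map_letter_Words[of w] by (intro Least_le bexI[of _ "map letter w"]) (auto intro: word_eq.refl)
  finally show ?thesis
    using n word_class_carrier[OF map_letter_Words] by (simp add: surface_group_def group_elem_def)
qed

lemma group_elem_eq_iff: "group_elem u = group_elem v \<longleftrightarrow> eqv u v"
  unfolding group_elem_def eqv_def by (rule word_class_eq_iff[OF map_letter_Words map_letter_Words])

text \<open>By \<open>acts_weq\<close> the height function depends only on the group element, and
  \<open>height_inj\<close> recovers the word from it.\<close>

lemma group_elem_inj: "inj_on group_elem {w. good (2 * g) w}"
proof (rule inj_onI)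
  fix u v assume uv: "u \<in> {w. good (2 * g) w}" "v \<in> {w. good (2 * g) w}" "group_elem u = group_elem v"
  have "weq (map letter u) (map letter v)" using uv(3) by (simp add: group_elem_eq_iff eqv_def)
  moreover have per: "periodic (\<lambda>_. 1)" by (simp add: periodic_def)
  ultimately have "height u = height v"
    unfolding height_def using acts_weq acts_index_letter by metis
  then show "u = v" using uv height_inj by simp
qed

lemma card_good_words_le_ball: "card (good_words (2 * g) n) \<le> ball_size (surface_group g) (surface_gens g) n"
  unfolding ball_size_def
  by (rule card_inj_on_le[OF inj_on_subset[OF group_elem_inj] _ finite_surface_ball])
    (auto simp: good_words_def simp del: mem_Collect_eq intro!: group_elem_in_ball)

text \<open>A shortest representative is good: a cancelling pair could be deleted, and a run of
  length \<open>2 * g + 1\<close> replaced by \<open>run_shortens\<close>.\<close>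

lemma ball_subset: "ball n \<subseteq> group_elem ` (\<Union>k\<le>n. good_words (2 * g + 1) k)"
proof
  fix x assume "x \<in> ball n"
  then have x: "x \<in> carrier (surface_group g)" "word_length (surface_group g) (surface_gens g) x \<le> n"
    by auto
  obtain u where u: "u \<in> Words" "x = word_rel {1..2 * g} {surface_relator g} `` {u}"
    using x(1) unfolding surface_group_def by (rule carrierE_word_class)
  define P where "P k \<longleftrightarrow> (\<exists>v\<in>Words. length v = k \<and> weq v u)" for k
  have wl: "word_length (surface_group g) (surface_gens g) x = (LEAST k. P k)"
    unfolding surface_group_def surface_gens_def u(2) P_def by (rule word_length_word_class[OF u(1)])
  have "P (length u)" using u(1) by (auto simp: P_def intro: word_eq.refl)
  then have "P (LEAST k. P k)" by (rule LeastI)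
  then obtain v where v: "v \<in> Words" "length v = (LEAST k. P k)" "weq v u" by (auto simp: P_def)
  define w where "w = map (\<lambda>l. index l mod N) v"
  have wv: "map letter w = v"
  proof -
    have "set v \<subseteq> {1..2 * g} \<times> UNIV" using v(1) by (auto simp: words_def)
    then show ?thesis unfolding w_def map_map
      by (intro map_idI) (auto simp: letter_mod letter_index)
  qed
  have min: "\<not> length w' < length w" if "eqv w w'" for w'
  proof -
    have "weq (map letter w') u"
      using eqv_sym[OF that] v(3) word_eq.trans unfolding eqv_def wv by blast
    then have "P (length w')" using map_letter_Words by (auto simp: P_def intro!: bexI[of _ "map letter w'"])
    then have "(LEAST k. P k) \<le> length w'" by (rule Least_le)
    then show ?thesis by (simp add: w_def v(2))
  qed
  have "good (2 * g + 1) w"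
    unfolding good_def
  proof (intro conjI allI ballI)
    show "set w \<subseteq> {0..<N}" using g2 by (auto simp: w_def)
    show "successively (\<lambda>x y. y \<noteq> opp x mod N) w"
    proof (rule ccontr)
      assume "\<not> ?thesis"
      then obtain p a b q where w: "w = p @ [a, b] @ q" "b = opp a mod N"
        by (rule not_successivelyE) blast
      have "weq (map letter p @ [(fst (letter a), snd (letter a)), (fst (letter a), \<not> snd (letter a))] @ map letter q)
          (map letter p @ map letter q)"
        using fst_letter by (intro word_eq.cancel map_letter_Words)
      then have "eqv w (p @ q)"
        by (simp add: eqv_def w letter_mod letter_opp)
      then show False using min w(1) by fastforce
    qed
    fix j e :: int assume e: "e \<in> {1, -1}"
    show "\<not> sublist (run j e (2 * g + 1)) w"
    proof
      assume "sublist (run j e (2 * g + 1)) w"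
      then obtain p q where w: "w = p @ run j e (2 * g + 1) @ q" by (auto simp: sublist_def)
      obtain v where v: "eqv (run j e (2 * g + 1)) v" "length v < 2 * g + 1"
        using run_shortens[OF e] .
      have "eqv w (p @ v @ q)"
        unfolding w by (intro eqv_append eqv_refl v(1))
      then show False using min[of "p @ v @ q"] v(2) by (simp add: w)
    qed
  qed
  moreover have "length w \<le> n" using x(2) by (simp add: w_def v(2) wl)
  moreover have "x = group_elem w"
    unfolding group_elem_def wv u(2) using word_class_eq_iff[OF u(1) v(1)] word_eq.sym[OF v(3)] by blast
  ultimately show "x \<in> group_elem ` (\<Union>k\<le>n. good_words (2 * g + 1) k)"
    by (auto simp: good_words_def)
qed

lemma ball_le_sum_good_words:
  "ball_size (surface_group g) (surface_gens g) n \<le> (\<Sum>k\<le>n. card (good_words (2 * g + 1) k))"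
proof -
  have "ball_size (surface_group g) (surface_gens g) n \<le> card (\<Union>k\<le>n. good_words (2 * g + 1) k)"
    unfolding ball_size_def
    by (rule surj_card_le[OF _ ball_subset]) (simp add: finite_good_words)
  also have "\<dots> \<le> (\<Sum>k\<le>n. card (good_words (2 * g + 1) k))"
    by (rule card_UN_le) simp
  finally show ?thesis .
qed

section \<open>Counting good words\<close>

definition extensions :: "int list \<Rightarrow> int set" where
  "extensions u = {y \<in> {0..<N}. u \<noteq> [] \<longrightarrow> y \<noteq> opp (last u) mod N}"

lemma finite_extensions: "finite (extensions u)"
  by (rule finite_subset[of _ "{0..<N}"]) (auto simp: extensions_def)

lemma card_extensions: "card (extensions u) = (if u = [] then 4 * g else 4 * g - 1)"
proof (cases "u = []")
  case True
  then have "extensions u = {0..<N}" by (auto simp: extensions_def)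
  then show ?thesis using True by (simp add: nat_mult_distrib)
next
  case False
  then have "extensions u = {0..<N} - {opp (last u) mod N}" by (auto simp: extensions_def)
  moreover have "opp (last u) mod N \<in> {0..<N}" using g2 by simp
  ultimately show ?thesis using False by (simp add: nat_mult_distrib)
qed

lemma run_nth: "i < n \<Longrightarrow> run j e n ! i = (j + int i * (2 * int g + e)) mod N"
  by (simp add: run_def)

text \<open>The first letter determines \<open>j\<close> and the second one \<open>e\<close>, since
  \<open>N\<close> does not divide \<open>2\<close>.\<close>

lemma run_inj:
  assumes "m \<ge> 2"
  shows "inj_on (\<lambda>(j, e). run j e m) ({0..<N} \<times> {1, -1})"
proof (rule inj_onI, clarify)
  fix i e j e'
  assume ij: "i \<in> {0..<N}" "j \<in> {0..<N}" and e: "e \<in> {1, -1 :: int}" "e' \<in> {1, -1 :: int}"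
    and eq: "run i e m = run j e' m"
  have "i = j"
    using arg_cong[OF eq, of "\<lambda>w. w ! 0"] ij assms by (simp add: run_nth)
  moreover have "(i + (2 * int g + e)) mod N = (j + (2 * int g + e')) mod N"
    using arg_cong[OF eq, of "\<lambda>w. w ! 1"] assms by (simp add: run_nth)
  ultimately have "N dvd e - e'" by (simp add: mod_eq_dvd_iff)
  then have "e = e'" using e g2 by (auto simp: zdvd_not_zless)
  with \<open>i = j\<close> show "i = j \<and> e = e'" by simp
qed

definition tails :: "int \<Rightarrow> nat \<Rightarrow> int list set" where
  "tails z k = {v. length v = k \<and> set v \<subseteq> {0..<N} \<and> successively (\<lambda>x y. y \<noteq> opp x mod N) (z # v)}"

lemma finite_tails: "finite (tails z k)"
  by (rule finite_subset[OF _ finite_lists_length_eq[of "{0..<N}" k]]) (auto simp: tails_def)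

lemma card_tails: "card (tails z k) = (4 * g - 1) ^ k"
proof (induction k arbitrary: z)
  case 0
  have "tails z 0 = {[]}" by (auto simp: tails_def)
  then show ?case by simp
next
  case (Suc k)
  have "tails z (Suc k) = (\<lambda>(y, v). y # v) ` (SIGMA y:extensions [z]. tails y k)"
    by (auto simp: tails_def extensions_def length_Suc_conv image_iff)
  moreover have "inj_on (\<lambda>(y, v). y # v) (SIGMA y:extensions [z]. tails y k)"
    by (auto simp: inj_on_def)
  ultimately have "card (tails z (Suc k)) = card (SIGMA y:extensions [z]. tails y k)"
    by (simp add: card_image)
  also have "\<dots> = (4 * g - 1) ^ Suc k"
    by (simp add: finite_extensions finite_tails Suc card_extensions)
  finally show ?case .
qed

text \<open>Inside a run each letter differs from the inverse of its predecessor by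
  \<open>e\<close>, which is not divisible by \<open>N\<close>.\<close>

lemma run_in_tails:
  assumes "j \<in> extensions [z]" "e \<in> {1, -1}"
  shows "run j e k \<in> tails z k"
proof -
  have "successively (\<lambda>x y. y \<noteq> opp x mod N) (z # run j e k) \<and>
      (k > 0 \<longrightarrow> last (run j e k) = (j + int (k - 1) * (2 * int g + e)) mod N)"
  proof (induction k)
    case (Suc k)
    have "(j + int k * (2 * int g + e)) mod N \<noteq> opp (last (z # run j e k)) mod N"
    proof (cases k)
      case 0
      then show ?thesis using assms by (simp add: run_def extensions_def)
    next
      case (Suc l)
      then have last: "last (z # run j e k) = (j + int l * (2 * int g + e)) mod N"
        using \<open>_ \<and> (k > 0 \<longrightarrow> _)\<close> by (simp add: run_def)
      have "\<not> N dvd e" by (rule not_dvd_unit[OF assms(2)])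
      moreover have "(j + int k * (2 * int g + e)) - opp (j + int l * (2 * int g + e)) = e"
        by (simp add: Suc algebra_simps)
      ultimately have "(j + int k * (2 * int g + e)) mod N \<noteq> opp (j + int l * (2 * int g + e)) mod N"
        by (simp add: mod_eq_dvd_iff)
      then show ?thesis unfolding last mod_add_left_eq .
    qed
    then show ?case using Suc successively_append_iff[of _ "z # run j e k"] by (simp add: run_Suc)
  qed (simp add: run_def)
  moreover have "set (run j e k) \<subseteq> {0..<N}" using g2 by (auto simp: run_def)
  ultimately show ?thesis by (simp add: tails_def run_def)
qed

text \<open>The last \<open>m\<close> letters form a reduced continuation of a non-empty prefix that
  is not a run. The excluded runs have \<open>4 * g - 1\<close> possible first letters and two
  directions.\<close>

lemma card_good_words_add_le:
  assumes "n \<ge> 1" "m \<ge> 2"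
  shows "card (good_words m (n + m)) \<le> card (good_words m n) * ((4 * g - 1) ^ m - (8 * g - 2))"
proof -
  define runs where "runs z = (\<lambda>(j, e). run j e m) ` (extensions [z] \<times> {1, -1})" for z
  have runs: "runs z \<subseteq> tails z m" "card (runs z) = 8 * g - 2" for z
  proof -
    show "runs z \<subseteq> tails z m" unfolding runs_def using run_in_tails by auto
    have "inj_on (\<lambda>(j, e). run j e m) (extensions [z] \<times> {1, -1})"
      by (rule inj_on_subset[OF run_inj[OF assms(2)]]) (auto simp: extensions_def)
    then show "card (runs z) = 8 * g - 2"
      by (simp add: runs_def card_image card_cartesian_product card_extensions)
  qed
  have c: "card (tails z m - runs z) = (4 * g - 1) ^ m - (8 * g - 2)" for z
    using card_Diff_subset[OF finite_subset[OF runs(1) finite_tails] runs(1)] runs(2) card_tails by simp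
  let ?T = "SIGMA u:good_words m n. tails (last u) m - runs (last u)"
  have "good_words m (n + m) \<subseteq> (\<lambda>(u, v). u @ v) ` ?T"
  proof
    fix w assume "w \<in> good_words m (n + m)"
    then have w: "good m w" "length w = n + m" by (auto simp: good_words_def)
    define u v where "u = take n w" and "v = drop n w"
    have uv: "w = u @ v" "length u = n" "length v = m" using w by (auto simp: u_def v_def)
    have u: "good m u" using good_appendD w(1) uv(1) by blast
    have "u \<noteq> []" "v \<noteq> []" using uv assms by auto
    then have "v \<in> tails (last u) m"
      using w(1) uv by (cases v) (auto simp: tails_def good_def successively_append_iff)
    moreover have "v \<notin> runs (last u)"
    proof
      assume "v \<in> runs (last u)"
      then obtain j e where "e \<in> {1, -1}" "v = run j e m" by (auto simp: runs_def)
      then show False using w(1) uv(1) sublist_append_leftI[of v u] unfolding good_def by blast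
    qed
    ultimately show "w \<in> (\<lambda>(u, v). u @ v) ` ?T"
      using u uv by (intro image_eqI[of _ _ "(u, v)"]) (auto simp: good_words_def)
  qed
  then have "card (good_words m (n + m)) \<le> card ?T"
    by (intro surj_card_le) (auto intro: finite_good_words finite_tails)
  also have "\<dots> = card (good_words m n) * ((4 * g - 1) ^ m - (8 * g - 2))"
    using finite_good_words finite_tails c by (subst card_SigmaI) auto
  finally show ?thesis .
qed

text \<open>A reduced one-letter extension that is not good ends in a run of length
  \<open>m\<close>. It is determined by the good prefix before the run, the first letter of the run
  and the direction; the empty prefix allows one more first letter.\<close>

lemma card_good_words_Suc_ge:
  assumes "m \<ge> 2"
  shows "(4 * g - 1) * card (good_words m n) \<le> card (good_words m (Suc n)) +
    (if Suc n < m then 0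
     else card (good_words m (Suc n - m)) * (if Suc n = m then 8 * g else 8 * g - 2))"
proof -
  let ?E = "SIGMA w:good_words m n. extensions w"
  define Bad where "Bad = {u @ run j e m |u j e. good m u \<and> length u + m = Suc n \<and> j \<in> extensions u \<and> e \<in> {1, -1}}"
  let ?S = "SIGMA u:good_words m (Suc n - m). extensions u \<times> {1, -1 :: int}"
  have S: "finite ?S"
    by (auto intro!: finite_SigmaI finite_good_words finite_extensions)
  have Bad: "Bad \<subseteq> (\<lambda>(u, j, e). u @ run j e m) ` ?S"
  proof
    fix x assume "x \<in> Bad"
    then obtain u j e where x: "x = u @ run j e m" "good m u" "length u + m = Suc n" "j \<in> extensions u" "e \<in> {1, -1}"
      by (auto simp: Bad_def)
    then show "x \<in> (\<lambda>(u, j, e). u @ run j e m) ` ?S"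
      by (intro image_eqI[of _ _ "(u, j, e)"]) (auto simp: good_words_def)
  qed
  have "(4 * g - 1) * card (good_words m n) = (\<Sum>w\<in>good_words m n. 4 * g - 1)"
    by simp
  also have "\<dots> \<le> (\<Sum>w\<in>good_words m n. card (extensions w))"
    by (intro sum_mono) (simp add: card_extensions)
  also have "\<dots> = card ?E"
    by (subst card_SigmaI) (simp_all add: finite_good_words finite_extensions)
  also have "\<dots> = card ((\<lambda>(w, y). w @ [y]) ` ?E)"
    by (subst card_image) (auto simp: inj_on_def)
  also have "\<dots> \<le> card (good_words m (Suc n) \<union> Bad)"
  proof (rule card_mono)
    show "finite (good_words m (Suc n) \<union> Bad)"
      using finite_subset[OF Bad finite_imageI[OF S]] by (simp add: finite_good_words)
    show "(\<lambda>(w, y). w @ [y]) ` ?E \<subseteq> good_words m (Suc n) \<union> Bad"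
    proof clarify
      fix w y assume w: "w \<in> good_words m n" and y: "y \<in> extensions w" and nb: "w @ [y] \<notin> Bad"
      have w': "good m w" "length w = n" using w by (auto simp: good_words_def)
      have y': "0 \<le> y" "y < N" "w \<noteq> [] \<longrightarrow> y \<noteq> opp (last w) mod N" using y by (auto simp: extensions_def)
      have "\<not> suffix (run j e m) (w @ [y])" if e: "e \<in> {1, -1}" for j e
      proof
        assume "suffix (run j e m) (w @ [y])"
        then obtain u where u: "w @ [y] = u @ run j e m" by (auto simp: suffix_def)
        \<comment> \<open>Without its last letter the run lies in \<open>w\<close>, so
          \<open>u\<close> is a prefix of the good word \<open>w\<close>.\<close>
        obtain m' where m': "m = Suc m'" using assms by (cases m) auto
        have "w = u @ run j e m'" using u by (simp add: m' run_Suc)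
        then have "good m u" using w'(1) good_appendD by blast
        have red: "successively (\<lambda>x y. y \<noteq> opp x mod N) (u @ run j e m)"
          unfolding u[symmetric] using w' y' by (auto simp: good_def successively_append_iff)
        have "hd (run j e m) = j mod N" using m' by (simp add: run_def hd_map del: upt_Suc)
        then have "j mod N \<in> extensions u"
          using red g2 run_nonempty[of m j e] m' by (auto simp: extensions_def successively_append_iff)
        moreover have "run (j mod N) e m = run j e m" by (rule run_cong) (simp add: mod_eq_dvd_iff[symmetric])
        moreover have "length u + m = Suc n" using arg_cong[OF u, of length] w'(2) by simp
        ultimately have "w @ [y] \<in> Bad"
          unfolding Bad_def mem_Collect_eq using u \<open>good m u\<close> e
          by (intro exI[of _ u] exI[of _ "j mod N"] exI[of _ e]) simp
        with nb show False by simp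
      qed
      then show "w @ [y] \<in> good_words m (Suc n)"
        using w' y' by (auto simp: good_words_def good_snoc)
    qed
  qed
  also have "\<dots> \<le> card (good_words m (Suc n)) + card Bad" by (rule card_Un_le)
  also have "card Bad \<le> (if Suc n < m then 0
     else card (good_words m (Suc n - m)) * (if Suc n = m then 8 * g else 8 * g - 2))"
  proof (cases "Suc n < m")
    case True
    then have "Bad = {}" by (auto simp: Bad_def)
    then show ?thesis by simp
  next
    case False
    have "card Bad \<le> card ?S" by (rule surj_card_le[OF S Bad])
    also have "\<dots> = (\<Sum>u\<in>good_words m (Suc n - m). 2 * card (extensions u))"
      by (subst card_SigmaI) (auto simp: finite_good_words finite_extensions card_cartesian_product mult_2)
    also have "\<dots> = (\<Sum>u\<in>good_words m (Suc n - m). if Suc n = m then 8 * g else 8 * g - 2)"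
      using False by (intro sum.cong) (auto simp: card_extensions good_words_def)
    finally show ?thesis using False by simp
  qed
  finally show ?thesis by simp
qed

lemma card_good_words_0: "m > 0 \<Longrightarrow> card (good_words m 0) = 1"
proof -
  assume "m > 0"
  then have "good_words m 0 = {[]}" by (auto simp: good_words_def good_Nil)
  then show ?thesis by simp
qed

section \<open>Growth rates of good words and balls\<close>

text \<open>A crude ratio comes first. By induction the count grew at least by
  \<open>q ^ (2 * g - 1) \<ge> 8 * g\<close> over the preceding \<open>2 * g - 1\<close> steps, so
  the bad extensions number at most the current count and lower the factor \<open>4 * g - 1\<close>
  by at most one.\<close>

lemma good_words_ratio:
  "real (card (good_words (2 * g) (Suc n))) \<ge> (4 * real g - 2) * real (card (good_words (2 * g) n))"
proof (induction n rule: less_induct)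
  case (less n)
  define f where "f n = real (card (good_words (2 * g) n))" for n
  define q where "q = 4 * real g - 2"
  have q: "q \<ge> 6" using g2 by (simp add: q_def)
  have rec: "(4 * real g - 1) * f n \<le> f (Suc n) +
      (if Suc n < 2 * g then 0 else f (Suc n - 2 * g) * (8 * real g))"
  proof -
    have "(4 * g - 1) * card (good_words (2 * g) n) \<le> card (good_words (2 * g) (Suc n)) +
      (if Suc n < 2 * g then 0 else card (good_words (2 * g) (Suc n - 2 * g)) * (8 * g))"
      using g2 by (intro order_trans[OF card_good_words_Suc_ge add_left_mono]) auto
    then have "real ((4 * g - 1) * card (good_words (2 * g) n)) \<le> real (card (good_words (2 * g) (Suc n)) +
      (if Suc n < 2 * g then 0 else card (good_words (2 * g) (Suc n - 2 * g)) * (8 * g)))"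
      by (rule of_nat_mono)
    then show ?thesis using g2 by (simp add: f_def of_nat_diff split: if_splits)
  qed
  show ?case
  proof (cases "Suc n < 2 * g")
    case True
    have "f n \<ge> 0" by (simp add: f_def)
    then show ?thesis using rec True by (simp add: f_def algebra_simps)
  next
    case False
    define k where "k = Suc n - 2 * g"
    have k: "n = k + (2 * g - 1)" using False g2 by (simp add: k_def)
    have "f (k + i) \<ge> q ^ i * f k" if "i \<le> 2 * g - 1" for i
      using that
    proof (induction i)
      case (Suc i)
      have "q ^ Suc i * f k \<le> q * f (k + i)" using Suc q by simp
      also have "\<dots> \<le> f (Suc (k + i))"
        using less.IH[of "k + i"] Suc.prems k by (simp add: f_def q_def)
      finally show ?case by simp
    qed simp
    then have fn: "q ^ (2 * g - 1) * f k \<le> f n" using k by simp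
    have "8 * real g \<le> 6 * q" using g2 by (simp add: q_def)
    also have "\<dots> \<le> q * q" using q by (intro mult_right_mono) auto
    also have "\<dots> = q ^ 2" by (simp add: power2_eq_square)
    also have "\<dots> \<le> q ^ (2 * g - 1)" using q g2 by (intro power_increasing) auto
    finally have "f k * (8 * real g) \<le> f k * q ^ (2 * g - 1)" by (rule mult_left_mono) (simp add: f_def)
    then have "f k * (8 * real g) \<le> f n" using fn by (simp add: mult.commute)
    then show ?thesis using rec False by (simp add: f_def k_def algebra_simps)
  qed
qed

lemma good_words_ratio_power:
  "real (card (good_words (2 * g) (n + i))) \<ge> (4 * real g - 2) ^ i * real (card (good_words (2 * g) n))"
proof (induction i)
  case (Suc i)
  have "(4 * real g - 2) ^ Suc i * real (card (good_words (2 * g) n)) \<le>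
      (4 * real g - 2) * real (card (good_words (2 * g) (n + i)))"
    using Suc g2 by simp
  also have "\<dots> \<le> real (card (good_words (2 * g) (n + Suc i)))" using good_words_ratio by simp
  finally show ?case .
qed simp

text \<open>The crude ratio bounds the earlier count \<open>f k\<close> by
  \<open>f n / q ^ (2 * g - 1)\<close>; inserting this in the recursion improves the ratio to
  \<open>r\<close>. For \<open>n \<ge> 2 * g\<close> the prefix before a run is not empty.\<close>

lemma good_words_growth_ge:
  defines "r \<equiv> 4 * real g - 1 - (8 * real g - 1) / (4 * real g - 2) ^ (2 * g - 1)"
  obtains c where "c > 0" "r > 0" "\<And>n. n \<ge> 2 * g \<Longrightarrow> c * r ^ n \<le> real (card (good_words (2 * g) n))"
proof -
  define f where "f n = real (card (good_words (2 * g) n))" for n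
  define q where "q = 4 * real g - 2"
  have q: "q \<ge> 6" using g2 by (simp add: q_def)
  have "(8 * real g - 1) \<le> q * q" using q mult_right_mono[of 6 q q] by (simp add: q_def)
  also have "\<dots> = q ^ 2" by (simp add: power2_eq_square)
  also have "\<dots> \<le> q ^ (2 * g - 1)" using q g2 by (intro power_increasing) auto
  finally have "(8 * real g - 1) / q ^ (2 * g - 1) \<le> 1" using q by simp
  moreover have "r = q + 1 - (8 * real g - 1) / q ^ (2 * g - 1)" by (simp add: r_def q_def)
  ultimately have r: "r > 0" using q by linarith
  have step: "r * f n \<le> f (Suc n)" if n: "n \<ge> 2 * g" for n
  proof -
    define k where "k = Suc n - 2 * g"
    have k: "n = k + (2 * g - 1)" using n g2 by (simp add: k_def)
    have "(4 * g - 1) * card (good_words (2 * g) n) \<le>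
        card (good_words (2 * g) (Suc n)) + card (good_words (2 * g) k) * (8 * g - 2)"
      using card_good_words_Suc_ge[of "2 * g" n] g2 n by (simp add: k_def)
    then have "real ((4 * g - 1) * card (good_words (2 * g) n)) \<le>
        real (card (good_words (2 * g) (Suc n)) + card (good_words (2 * g) k) * (8 * g - 2))"
      by (rule of_nat_mono)
    then have "(4 * real g - 1) * f n \<le> f (Suc n) + f k * (8 * real g - 2)"
      using g2 by (simp add: f_def of_nat_diff)
    also have "f k * (8 * real g - 2) \<le> f k * (8 * real g - 1)"
      by (intro mult_left_mono) (simp_all add: f_def)
    also have "\<dots> \<le> f n / q ^ (2 * g - 1) * (8 * real g - 1)"
    proof (rule mult_right_mono)
      have "q ^ (2 * g - 1) * f k \<le> f n"
        unfolding f_def q_def using good_words_ratio_power[of "2 * g - 1" k] k by simp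
      then show "f k \<le> f n / q ^ (2 * g - 1)" using q by (simp add: field_simps)
    qed (use g2 in simp)
    finally have "(4 * real g - 1) * f n \<le> f (Suc n) + f n / q ^ (2 * g - 1) * (8 * real g - 1)" by simp
    moreover have "r * f n = (4 * real g - 1) * f n - f n / q ^ (2 * g - 1) * (8 * real g - 1)"
      unfolding r_def q_def left_diff_distrib[of "4 * real g - 1"] by (simp add: mult.commute)
    ultimately show ?thesis by linarith
  qed
  have pow: "r ^ i * f (2 * g) \<le> f (2 * g + i)" for i
  proof (induction i)
    case (Suc i)
    have "r ^ Suc i * f (2 * g) \<le> r * f (2 * g + i)" using Suc r by simp
    also have "\<dots> \<le> f (2 * g + Suc i)" using step[of "2 * g + i"] by simp
    finally show ?case .
  qed simp
  have f0: "f (2 * g) > 0"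
  proof -
    have "0 < q ^ (2 * g) * f 0" using q g2 by (simp add: f_def card_good_words_0)
    then show ?thesis using good_words_ratio_power[of "2 * g" 0] by (simp add: f_def q_def)
  qed
  show ?thesis
  proof (rule that[of "f (2 * g) / r ^ (2 * g)"])
    fix n assume n: "n \<ge> 2 * g"
    then have "r ^ n = r ^ (2 * g) * r ^ (n - 2 * g)" by (simp flip: power_add)
    then show "f (2 * g) / r ^ (2 * g) * r ^ n \<le> real (card (good_words (2 * g) n))"
      using pow[of "n - 2 * g"] n r by (simp add: f_def mult.commute)
  qed (use f0 r in auto)
qed

text \<open>Appending a block of \<open>k\<close> letters multiplies the count by at most
  \<open>r ^ k\<close>.\<close>

lemma good_words_growth_le:
  defines "r \<equiv> 4 * real g - 1 - 2 / (4 * real g - 1) ^ (2 * g)"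
  obtains C where "C > 0" "r \<ge> 1" "\<And>n. real (card (good_words (2 * g + 1) n)) \<le> C * r ^ n"
proof -
  define d where "d = 4 * real g - 1"
  define k where "k = 2 * g + 1"
  define a where "a n = real (card (good_words k n))" for n
  have d: "d \<ge> 7" using g2 by (simp add: d_def)
  have d1: "1 \<le> d ^ (2 * g)" using d by (intro one_le_power) simp
  then have "2 / d ^ (2 * g) \<le> 2" using d by (simp add: divide_le_eq)
  then have r: "r \<ge> 1" using d by (simp add: r_def d_def)
  \<comment> \<open>Bernoulli's inequality for \<open>r = d * (1 - 2 / d ^ k)\<close>; the loss is
    \<open>2 * k = 4 * g + 2\<close>, which is at most \<open>8 * g - 2\<close>.\<close>
  have rk: "d ^ k - (4 * real g + 2) \<le> r ^ k"
  proof -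
    have "r = d - 2 / d ^ (2 * g)" by (simp add: r_def d_def)
    also have "2 / d ^ (2 * g) = d * (2 / d ^ k)" using d by (simp add: k_def)
    finally have "r = d * (1 + - (2 / d ^ k))" by (simp add: right_diff_distrib)
    moreover have "1 + real k * - (2 / d ^ k) \<le> (1 + - (2 / d ^ k)) ^ k"
    proof (rule Bernoulli_inequality)
      have "2 \<le> d ^ k" using d d1 mult_mono[of 2 d 1 "d ^ (2 * g)"] by (simp add: k_def)
      then show "- 1 \<le> - (2 / d ^ k)" by simp
    qed
    ultimately have "d ^ k * (1 + real k * - (2 / d ^ k)) \<le> r ^ k"
      using d by (simp add: power_mult_distrib)
    also have "d ^ k * (1 + real k * - (2 / d ^ k)) = d ^ k - (4 * real g + 2)"
      using d by (simp add: k_def field_simps)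
    finally show ?thesis .
  qed
  have sub: "real ((4 * g - 1) ^ k - (8 * g - 2)) \<le> r ^ k"
  proof (cases "8 * g - 2 \<le> (4 * g - 1) ^ k")
    case True
    then have "real ((4 * g - 1) ^ k - (8 * g - 2)) = d ^ k - (8 * real g - 2)"
      using g2 by (simp add: of_nat_diff d_def)
    then show ?thesis using rk g2 by simp
  next
    \<comment> \<open>The truncated subtraction gives \<open>0\<close> here.\<close>
    case False
    then show ?thesis using r by simp
  qed
  \<comment> \<open>The base case includes \<open>n = k\<close>, because
    \<open>card_good_words_add_le\<close> asks for a non-empty prefix.\<close>
  define C where "C = (\<Sum>i\<le>k. a i)"
  have aC: "a n \<le> C" if "n \<le> k" for n
    unfolding C_def using that by (intro member_le_sum) (auto simp: a_def)
  have C: "C > 0" using aC[of 0] by (simp add: a_def k_def card_good_words_0)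
  have "a n \<le> C * r ^ n" for n
  proof (induction n rule: less_induct)
    case (less n)
    show ?case
    proof (cases "n \<le> k")
      case True
      have "C * 1 \<le> C * r ^ n" using C r by (intro mult_left_mono one_le_power) auto
      then show ?thesis using aC[OF True] by simp
    next
      case False
      define n' where "n' = n - k"
      have n': "n = n' + k" "1 \<le> n'" "n' < n" using False by (auto simp: n'_def k_def)
      have "a n \<le> a n' * real ((4 * g - 1) ^ k - (8 * g - 2))"
        using card_good_words_add_le[OF n'(2), of k] g2
        unfolding a_def n'(1) of_nat_mult[symmetric] by (intro of_nat_mono) (simp add: k_def)
      also have "\<dots> \<le> (C * r ^ n') * r ^ k"
        using less.IH[OF n'(3)] sub C r by (intro mult_mono) (auto simp: a_def)
      finally show ?thesis by (simp add: n'(1) power_add mult.assoc)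
    qed
  qed
  then show ?thesis using that[of C] C r by (simp add: a_def k_def)
qed

text \<open>Summing over lengths costs a factor \<open>n + 1 \<le> 2 * n\<close>, which disappears
  under the \<open>n\<close>-th root.\<close>

lemma ball_size_le:
  defines "r \<equiv> 4 * real g - 1 - 2 / (4 * real g - 1) ^ (2 * g)"
  obtains C where "C > 0" "r \<ge> 1"
    "\<And>n. n \<ge> 1 \<Longrightarrow> real (ball_size (surface_group g) (surface_gens g) n) \<le> C * real n * r ^ n"
proof -
  obtain C where C: "C > 0" and r: "r \<ge> 1"
    and le: "\<And>n. real (card (good_words (2 * g + 1) n)) \<le> C * r ^ n"
    using good_words_growth_le unfolding r_def by blast
  show ?thesis
  proof (rule that[of "2 * C"])
    fix n :: nat assume n: "n \<ge> 1"
    have "real (ball_size (surface_group g) (surface_gens g) n) \<le>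
        real (\<Sum>k\<le>n. card (good_words (2 * g + 1) k))"
      by (rule of_nat_mono[OF ball_le_sum_good_words])
    also have "\<dots> \<le> (\<Sum>k\<le>n. C * r ^ n)"
      unfolding of_nat_sum
    proof (rule sum_mono)
      fix k assume "k \<in> {..n}"
      then have "r ^ k \<le> r ^ n" using r by (intro power_increasing) auto
      then show "real (card (good_words (2 * g + 1) k)) \<le> C * r ^ n"
        using le[of k] C by (meson mult_le_cancel_left_pos order_trans)
    qed
    also have "\<dots> = (real n + 1) * (C * r ^ n)" by (simp add: add.commute)
    also have "\<dots> \<le> (2 * real n) * (C * r ^ n)" using n C r by (intro mult_right_mono) auto
    finally show "real (ball_size (surface_group g) (surface_gens g) n) \<le> 2 * C * real n * r ^ n"
      by (simp add: mult_ac)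
  qed (use C r in auto)
qed

end

section \<open>Limits superior of roots and the final bounds\<close>

lemma limsup_root_ge:
  fixes a :: "nat \<Rightarrow> real"
  assumes "c > 0" "r > 0" "\<And>n. n \<ge> n0 \<Longrightarrow> c * r ^ n \<le> a n"
  shows "ereal r \<le> limsup (\<lambda>n. ereal (root n (a n)))"
proof -
  have "(\<lambda>n. root n c * r) \<longlonglongrightarrow> 1 * r"
    by (intro tendsto_intros LIMSEQ_root_const assms)
  then have "limsup (\<lambda>n. ereal (root n c * r)) = ereal r"
    by (intro lim_imp_Limsup) auto
  moreover have "limsup (\<lambda>n. ereal (root n c * r)) \<le> limsup (\<lambda>n. ereal (root n (a n)))"
  proof (rule Limsup_mono, rule eventually_sequentiallyI[of "max 1 n0"])
    fix n assume n: "n \<ge> max 1 n0"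
    then have "root n (c * r ^ n) \<le> root n (a n)" using assms(3) by simp
    then show "ereal (root n c * r) \<le> ereal (root n (a n))"
      using n assms by (simp add: real_root_mult real_root_power_cancel)
  qed
  ultimately show ?thesis by simp
qed

text \<open>The roots of the constant and of the linear factor both tend to
  \<open>1\<close>.\<close>

lemma limsup_root_le:
  fixes a :: "nat \<Rightarrow> real"
  assumes "C > 0" "r \<ge> 0" "\<And>n. n \<ge> 1 \<Longrightarrow> a n \<le> C * real n * r ^ n"
  shows "limsup (\<lambda>n. ereal (root n (a n))) \<le> ereal r"
proof -
  have "(\<lambda>n. root n C * root n (real n) * r) \<longlonglongrightarrow> 1 * 1 * r"
    by (intro tendsto_intros LIMSEQ_root_const LIMSEQ_root assms)
  then have "limsup (\<lambda>n. ereal (root n C * root n (real n) * r)) = ereal r"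
    by (intro lim_imp_Limsup) auto
  moreover have "limsup (\<lambda>n. ereal (root n (a n))) \<le> limsup (\<lambda>n. ereal (root n C * root n (real n) * r))"
  proof (rule Limsup_mono, rule eventually_sequentiallyI[of 1])
    fix n :: nat assume n: "n \<ge> 1"
    then have "root n (a n) \<le> root n (C * real n * r ^ n)" using assms(3) by simp
    then show "ereal (root n (a n)) \<le> ereal (root n C * root n (real n) * r)"
      using n assms by (simp add: real_root_mult real_root_power_cancel)
  qed
  ultimately show ?thesis by simp
qed

theorem proposition9p3:
  fixes g :: nat
  assumes "g \<ge> 2"
  shows "ereal (4 * real g - 1 - (8 * real g - 1) / (4 * real g - 2) ^ (2 * g - 1))
           \<le> limsup (\<lambda>n. ereal (root n (real (ball_size (surface_group g) (surface_gens g) n))))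
       \<and> limsup (\<lambda>n. ereal (root n (real (ball_size (surface_group g) (surface_gens g) n))))
           \<le> ereal (4 * real g - 1 - 2 / (4 * real g - 1) ^ (2 * g))"
proof
  interpret surface g by standard (fact assms)
  obtain c where c: "c > 0" "4 * real g - 1 - (8 * real g - 1) / (4 * real g - 2) ^ (2 * g - 1) > 0"
    "\<And>n. n \<ge> 2 * g \<Longrightarrow>
      c * (4 * real g - 1 - (8 * real g - 1) / (4 * real g - 2) ^ (2 * g - 1)) ^ n \<le>
      real (card (good_words (2 * g) n))"
    using good_words_growth_ge by blast
  show "ereal (4 * real g - 1 - (8 * real g - 1) / (4 * real g - 2) ^ (2 * g - 1))
      \<le> limsup (\<lambda>n. ereal (root n (real (ball_size (surface_group g) (surface_gens g) n))))"
  proof (rule limsup_root_ge[OF c(1,2)])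
    fix n assume "n \<ge> 2 * g"
    from c(3)[OF this] card_good_words_le_ball[of n]
    show "c * (4 * real g - 1 - (8 * real g - 1) / (4 * real g - 2) ^ (2 * g - 1)) ^ n \<le>
        real (ball_size (surface_group g) (surface_gens g) n)"
      by (meson of_nat_mono order_trans)
  qed
  obtain C where C: "C > 0" "4 * real g - 1 - 2 / (4 * real g - 1) ^ (2 * g) \<ge> 1"
    "\<And>n. n \<ge> 1 \<Longrightarrow> real (ball_size (surface_group g) (surface_gens g) n) \<le>
      C * real n * (4 * real g - 1 - 2 / (4 * real g - 1) ^ (2 * g)) ^ n"
    using ball_size_le by blast
  show "limsup (\<lambda>n. ereal (root n (real (ball_size (surface_group g) (surface_gens g) n))))
      \<le> ereal (4 * real g - 1 - 2 / (4 * real g - 1) ^ (2 * g))"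
    using C by (intro limsup_root_le[of C]) auto
qed

end
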